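(* Let $(\mathcal{X},\mathcal{T})$ be a non-degenerate Banach $L^1(\mathbb{R})$-module with structure associated with an isometric representation $\mathcal{T}$, and assume that $h\in\mathcal{F}L^1_{loc}(\mathbb{R})$ is $\mathcal{X}$-regular. Then $\sigma(\check{\mathcal{T}}(h))=\overline{h(\Lambda(\mathcal{X},\mathcal{T}))}$. Moreover, given $\lambda\notin\overline{h(\Lambda(\mathcal{X},\mathcal{T}))}$, we have $(\lambda I-\check{\mathcal{T}}(h))^{-1}=\check{\mathcal{T}}(g_\lambda)$ (also written $\mathcal{T}(\check g_\lambda)$), where $g_\lambda\in\mathcal{F}L^1_{loc}(\mathbb{R})$ is the function from the definition of $\mathcal{X}$-regularity, i.e. $g_\lambda(\xi)(\lambda-h(\xi))=1$ for every $\xi$ in a neighborhood of $\Lambda(\mathcal{X},\mathcal{T})$ and $\check{\mathcal{T}}(g_\lambda)\in B(\mathcal{X})$.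
   Context: $\mathcal{X}$ is a complex Banach space, $B(\mathcal{X})$ is the algebra of bounded linear operators defined on all of $\mathcal{X}$. A Banach $L^1(\mathbb{R})$-module structure on $\mathcal{X}$ is a bilinear map $(f,x)\mapsto fx: L^1(\mathbb{R})\times\mathcal{X}\to\mathcal{X}$ with $(f*g)x=f(gx)$ (convolution) and $\|fx\|\le\|f\|_1\|x\|$. It is non-degenerate if $fx=0$ for all $f\in L^1(\mathbb{R})$ implies $x=0$. It is associated with an isometric representation (group homomorphism into isometries) $\mathcal{T}:\mathbb{R}\to B(\mathcal{X})$ if $\mathcal{T}(t)(fx)=f_tx=f(\mathcal{T}(t)x)$ for $t\in\mathbb{R}$, $f\in L^1(\mathbb{R})$, $x\in\mathcal{X}$, where $f_t(s)=f(t+s)$. For $f\in L^1(\mathbb{R})$ write $\mathcal{T}(f)\in B(\mathcal{X})$, $\mathcal{T}(f)x=fx$. Fourier transform: $\widehat f(\xi)=\int_{\mathbb{R}}f(t)e^{-it\xi}dt$; $\mathcal{F}L^1=\{\widehat f: f\in L^1(\mathbb{R})\}$, and $\check h$ or $h^\vee$ is the inverse Fourier transform of $h\in\mathcal{F}L^1$. Beurling spectrum: for $N\subseteq\mathcal{X}$, $\Lambda(N)=\Lambda(N,\mathcal{T})$ is the set of $\lambda\in\mathbb{R}$ such that for every $f\in L^1(\mathbb{R})$, if $fx=0$ for all $x\in N$ then $\widehat f(\lambda)=0$; $\Lambda(x)=\Lambda(\{x\})$. $\mathcal{X}_{comp}=\{x\in\mathcal{X}:\Lambda(x)\text{ is compact}\}$.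 $\mathcal{F}L^1_{loc}(\mathbb{R})$ is the set of $h:\mathbb{R}\to\mathbb{C}$ such that $h\widehat\varphi\in\mathcal{F}L^1$ for every $\varphi\in L^1(\mathbb{R})$ with $\operatorname{supp}\widehat\varphi$ compact. For $h\in\mathcal{F}L^1_{loc}(\mathbb{R})$ the closed operator $\check{\mathcal{T}}(h):D(\check{\mathcal{T}}(h))\subseteq\mathcal{X}\to\mathcal{X}$ is defined as follows: for $x\in\mathcal{X}_{comp}$, $\check{\mathcal{T}}(h)x=\mathcal{T}((h\widehat\varphi)^\vee)x$, where $\varphi\in L^1(\mathbb{R})$ is any function with $\operatorname{supp}\widehat\varphi$ compact and $\widehat\varphi\equiv1$ in a neighborhood of $\Lambda(x)$ (the result is independent of $\varphi$); then $\check{\mathcal{T}}(h)$ is the closure of this operator on $\mathcal{X}_{comp}$. A function $h\in\mathcal{F}L^1_{loc}(\mathbb{R})$ is called $\mathcal{X}$-regular if for any $\lambda\in\mathbb{C}\setminus\overline{h(\Lambda(\mathcal{X},\mathcal{T}))}$ there exists $g_\lambda\in\mathcal{F}L^1_{loc}(\mathbb{R})$ such that $g_\lambda(\xi)(\lambda-h(\xi))=1$ for every $\xi$ in a neighborhood of $\Lambda(\mathcal{X},\mathcal{T})$, and $\check{\mathcal{T}}(g_\lambda)$ belongs to $B(\mathcal{X})$. *)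

theory Defs
  imports "HOL-Analysis.Analysis"
begin

section \<open>Complex Banach spaces\<close>

class complex_banach = banach +
  fixes scaleC :: "complex \<Rightarrow> 'a \<Rightarrow> 'a" (infixr "*\<^sub>C" 75)
  assumes scaleC_add_right: "c *\<^sub>C (x + y) = c *\<^sub>C x + c *\<^sub>C y"
    and scaleC_add_left: "(c + d) *\<^sub>C x = c *\<^sub>C x + d *\<^sub>C x"
    and scaleC_scaleC: "c *\<^sub>C (d *\<^sub>C x) = (c * d) *\<^sub>C x"
    and scaleC_of_real: "complex_of_real r *\<^sub>C x = r *\<^sub>R x"
    and norm_scaleC: "norm (c *\<^sub>C x) = cmod c * norm x"

instantiation complex :: complex_banach
begin

definition scaleC_complex :: "complex \<Rightarrow> complex \<Rightarrow> complex" where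
  "scaleC_complex c x = c * x"

instance
  by standard
    (simp_all add: scaleC_complex_def algebra_simps norm_mult scaleR_conv_of_real)

end

definition bounded_clinear :: "('a::complex_banach \<Rightarrow> 'a) \<Rightarrow> bool" where
  "bounded_clinear S \<longleftrightarrow> bounded_linear S \<and> (\<forall>c x. S (c *\<^sub>C x) = c *\<^sub>C S x)"


section \<open>Possibly unbounded operators\<close>

text \<open>
  An operator with domain in \<open>'a\<close> is represented by its graph. The domain is the projection
  of the graph to the first component, two operators are equal iff their graphs are, the inverse
  of an injective operator is the converse relation, and the graph of the closure of a closable
  operator is the topological closure of its graph.
\<close>

definition graph_of :: "('a \<Rightarrow> 'a) \<Rightarrow> ('a \<times> 'a) set" where
  "graph_of S = {(x, S x) | x. True}"

definition in_B :: "('a::complex_banach \<times> 'a) set \<Rightarrow> bool" where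
  "in_B A \<longleftrightarrow> (\<exists>S. bounded_clinear S \<and> A = graph_of S)"

text \<open>The operator \<open>zI - A\<close> on the domain of \<open>A\<close>.\<close>

definition shift_op :: "complex \<Rightarrow> ('a::complex_banach \<times> 'a) set \<Rightarrow> ('a \<times> 'a) set" where
  "shift_op z A = {(x, z *\<^sub>C x - y) | x y. (x, y) \<in> A}"

definition op_resolvent_set :: "('a::complex_banach \<times> 'a) set \<Rightarrow> complex set" where
  "op_resolvent_set A = {z. in_B ((shift_op z A)\<inverse>)}"

definition op_spectrum :: "('a::complex_banach \<times> 'a) set \<Rightarrow> complex set" where
  "op_spectrum A = - op_resolvent_set A"


section \<open>The algebra of integrable functions and its Fourier image\<close>

text \<open>
  Elements of \<open>L\<^sup>1(\<real>)\<close> are represented by Borel measurable integrable functions. No quotient by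
  almost everywhere equality is taken: all notions below respect it, in particular a module
  action does so by additivity and the norm bound.
\<close>

definition L1 :: "(real \<Rightarrow> complex) set" where
  "L1 = {f. integrable lborel f}"

definition L1_norm :: "(real \<Rightarrow> complex) \<Rightarrow> real" where
  "L1_norm f = (LINT t|lborel. cmod (f t))"

definition convolution :: "(real \<Rightarrow> complex) \<Rightarrow> (real \<Rightarrow> complex) \<Rightarrow> real \<Rightarrow> complex" where
  "convolution f g = (\<lambda>t. LINT s|lborel. f s * g (t - s))"

definition fourier :: "(real \<Rightarrow> complex) \<Rightarrow> real \<Rightarrow> complex" where
  "fourier f = (\<lambda>\<xi>. LINT t|lborel. f t * exp (- (\<i> * of_real t * of_real \<xi>)))"

definition FL1 :: "(real \<Rightarrow> complex) set" where
  "FL1 = fourier ` L1"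

text \<open>For \<open>h\<close> in \<open>FL1\<close> the chosen function is unique up to almost everywhere equality.\<close>

definition inv_fourier :: "(real \<Rightarrow> complex) \<Rightarrow> real \<Rightarrow> complex" where
  "inv_fourier h = (SOME f. f \<in> L1 \<and> fourier f = h)"

definition supp :: "(real \<Rightarrow> complex) \<Rightarrow> real set" where
  "supp k = closure {\<xi>. k \<xi> \<noteq> 0}"

definition FL1_loc :: "(real \<Rightarrow> complex) set" where
  "FL1_loc = {h. \<forall>\<phi>\<in>L1. compact (supp (fourier \<phi>)) \<longrightarrow> (\<lambda>\<xi>. h \<xi> * fourier \<phi> \<xi>) \<in> FL1}"


section \<open>Banach modules over the integrable functions\<close>

locale L1_module =
  fixes act :: "(real \<Rightarrow> complex) \<Rightarrow> 'a::complex_banach \<Rightarrow> 'a"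
  assumes act_add_left: "\<lbrakk>f \<in> L1; g \<in> L1\<rbrakk> \<Longrightarrow> act (\<lambda>t. f t + g t) x = act f x + act g x"
    and act_scale_left: "f \<in> L1 \<Longrightarrow> act (\<lambda>t. c * f t) x = c *\<^sub>C act f x"
    and act_add_right: "f \<in> L1 \<Longrightarrow> act f (x + y) = act f x + act f y"
    and act_scale_right: "f \<in> L1 \<Longrightarrow> act f (c *\<^sub>C x) = c *\<^sub>C act f x"
    and act_convolution: "\<lbrakk>f \<in> L1; g \<in> L1\<rbrakk> \<Longrightarrow> act (convolution f g) x = act f (act g x)"
    and norm_act_le: "f \<in> L1 \<Longrightarrow> norm (act f x) \<le> L1_norm f * norm x"

definition nondegenerate :: "((real \<Rightarrow> complex) \<Rightarrow> 'a::complex_banach \<Rightarrow> 'a) \<Rightarrow> bool" where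
  "nondegenerate act \<longleftrightarrow> (\<forall>x. (\<forall>f\<in>L1. act f x = 0) \<longrightarrow> x = 0)"

locale isometric_representation =
  fixes T :: "real \<Rightarrow> 'a::complex_banach \<Rightarrow> 'a"
  assumes rep_bounded_clinear: "bounded_clinear (T t)"
    and rep_isometry: "norm (T t x) = norm x"
    and rep_zero: "T 0 = id"
    and rep_add: "T (s + t) = T s \<circ> T t"

definition associated ::
  "((real \<Rightarrow> complex) \<Rightarrow> 'a::complex_banach \<Rightarrow> 'a) \<Rightarrow> (real \<Rightarrow> 'a \<Rightarrow> 'a) \<Rightarrow> bool" where
  "associated act T \<longleftrightarrow>
     (\<forall>t. \<forall>f\<in>L1. \<forall>x. T t (act f x) = act (\<lambda>s. f (t + s)) x \<and>
                      act (\<lambda>s. f (t + s)) x = act f (T t x))"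

definition beurling_spectrum ::
  "((real \<Rightarrow> complex) \<Rightarrow> 'a::complex_banach \<Rightarrow> 'a) \<Rightarrow> 'a set \<Rightarrow> real set" where
  "beurling_spectrum act N = {\<xi>. \<forall>f\<in>L1. (\<forall>x\<in>N. act f x = 0) \<longrightarrow> fourier f \<xi> = 0}"

definition X_comp :: "((real \<Rightarrow> complex) \<Rightarrow> 'a::complex_banach \<Rightarrow> 'a) \<Rightarrow> 'a set" where
  "X_comp act = {x. compact (beurling_spectrum act {x})}"


section \<open>The operators attached to multipliers, and regularity\<close>

definition cutoff :: "real set \<Rightarrow> (real \<Rightarrow> complex) \<Rightarrow> bool" where
  "cutoff K \<phi> \<longleftrightarrow> \<phi> \<in> L1 \<and> compact (supp (fourier \<phi>)) \<and>
     (\<exists>U. open U \<and> K \<subseteq> U \<and> (\<forall>\<xi>\<in>U. fourier \<phi> \<xi> = 1))"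

text \<open>
  The value at \<open>x\<close> does not depend on the cutoff \<open>\<phi>\<close>, so the graph may be taken over all
  admissible \<open>\<phi>\<close>.
\<close>

definition multiplier_op_comp ::
  "((real \<Rightarrow> complex) \<Rightarrow> 'a::complex_banach \<Rightarrow> 'a) \<Rightarrow> (real \<Rightarrow> complex) \<Rightarrow> ('a \<times> 'a) set" where
  "multiplier_op_comp act h =
     {(x, act (inv_fourier (\<lambda>\<xi>. h \<xi> * fourier \<phi> \<xi>)) x) | x \<phi>.
        x \<in> X_comp act \<and> cutoff (beurling_spectrum act {x}) \<phi>}"

definition multiplier_op ::
  "((real \<Rightarrow> complex) \<Rightarrow> 'a::complex_banach \<Rightarrow> 'a) \<Rightarrow> (real \<Rightarrow> complex) \<Rightarrow> ('a \<times> 'a) set" where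
  "multiplier_op act h = closure (multiplier_op_comp act h)"

text \<open>\<open>g\<close> is an admissible choice of the function \<open>g\<^sub>z\<close> in the definition of regularity.\<close>

definition regularity_witness ::
  "((real \<Rightarrow> complex) \<Rightarrow> 'a::complex_banach \<Rightarrow> 'a) \<Rightarrow> (real \<Rightarrow> complex) \<Rightarrow> complex
     \<Rightarrow> (real \<Rightarrow> complex) \<Rightarrow> bool" where
  "regularity_witness act h z g \<longleftrightarrow> g \<in> FL1_loc \<and>
     (\<exists>U. open U \<and> beurling_spectrum act UNIV \<subseteq> U \<and> (\<forall>\<xi>\<in>U. g \<xi> * (z - h \<xi>) = 1)) \<and>
     in_B (multiplier_op act g)"

definition X_regular ::
  "((real \<Rightarrow> complex) \<Rightarrow> 'a::complex_banach \<Rightarrow> 'a) \<Rightarrow> (real \<Rightarrow> complex) \<Rightarrow> bool" where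
  "X_regular act h \<longleftrightarrow> h \<in> FL1_loc \<and>
     (\<forall>z. z \<notin> closure (h ` beurling_spectrum act UNIV) \<longrightarrow> (\<exists>g. regularity_witness act h z g))"

end

theory Submission
  imports Defs "HOL-Probability.Characteristic_Functions" "HOL-Probability.Sinc_Integral"
begin

text \<open>
  Write \<open>\<Lambda>\<close> for the spectrum of the module and \<open>A\<close> for the operator attached to \<open>h\<close>. On vectors with
  compact spectrum \<open>A\<close> acts through integrable functions, so that algebraic relations between
  functions near \<open>\<Lambda>\<close> become relations between operators.

  If \<open>g\<close> is a regularity witness for \<open>z\<close>, the relation \<open>g * (z - h) = 1\<close> near \<open>\<Lambda>\<close> says that on these
  vectors the operator of \<open>g\<close> and \<open>z - A\<close> are inverse to each other, and both preserve this set of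
  vectors. Hence the map \<open>(x, y) \<mapsto> (z *\<^sub>C x - y, x)\<close> carries the graph of \<open>h\<close> on vectors with compact
  spectrum exactly onto that of \<open>g\<close> (\<open>converse_shift_multiplier_op_comp\<close>). The map is a homeomorphism,
  so it carries the closure of one graph onto the closure of the other (\<open>converse_shift_closure\<close>). This is
  the formula for the inverse, and since the operator of \<open>g\<close> is bounded, \<open>z\<close> is in the resolvent set.

  Conversely, for \<open>c\<close> in \<open>\<Lambda>\<close> there are nonzero vectors with spectrum arbitrarily close to \<open>c\<close>. On them
  \<open>A\<close> is nearly multiplication by \<open>h c\<close> (\<open>multiplier_op_approximate_eigenvector\<close>), so \<open>z - A\<close> is not
  bounded below for \<open>z\<close> in the closure of the image of \<open>\<Lambda>\<close>.

  Both halves rest on localisation in frequency by explicit kernels \<open>bump c r\<close> with trapezoidal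
  Fourier transform. The basic estimate is that convolution with an integrable \<open>g\<close> multiplies a narrow
  bump at \<open>c\<close> by \<open>fourier g c\<close> up to a small error in \<open>L\<^sup>1\<close> (\<open>convolution_bump_approx\<close>), a consequence of
  the continuity of translations. It implies that \<open>act f x\<close> only depends on the transform of \<open>f\<close> near
  the spectrum of \<open>x\<close> (\<open>act_eqI_near_spectrum\<close>), and, by nondegeneracy, that a cutoff acts as the identity
  (\<open>act_cutoff\<close>).
\<close>

(* The short name stays with the convolution of functions; that of measures is hidden. *)
hide_const (open) Convolution.convolution
hide_fact (open) Convolution.convolution_def

section \<open>Continuity of translations in \<open>L\<^sup>1\<close>\<close>

lemma L1_diff: "f \<in> L1 \<Longrightarrow> g \<in> L1 \<Longrightarrow> (\<lambda>t. f t - g t) \<in> L1"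
  by (simp add: L1_def)

lemma L1_cmult: "f \<in> L1 \<Longrightarrow> (\<lambda>t. c * f t) \<in> L1"
  by (simp add: L1_def)

lemma L1_translate: "f \<in> L1 \<Longrightarrow> (\<lambda>t. f (t - s)) \<in> L1"
  using lborel_integrable_real_affine[of f 1 "-s"] by (simp add: L1_def)

lemma L1_norm_translate: "L1_norm (\<lambda>t. f (t - s)) = L1_norm f"
  unfolding L1_norm_def
  using lborel_integral_real_affine[of 1 "\<lambda>t. cmod (f t)" "-s"] by simp

text \<open>
  The \<open>L\<^sup>1\<close> modulus of continuity.
\<close>

definition transl_mod :: "(real \<Rightarrow> complex) \<Rightarrow> real \<Rightarrow> real" where
  "transl_mod f s = L1_norm (\<lambda>t. f (t - s) - f t)"

lemma L1_norm_nonneg: "0 \<le> L1_norm f"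
  by (simp add: L1_norm_def)

lemma L1_norm_add_le:
  assumes "f \<in> L1" "g \<in> L1"
  shows "L1_norm (\<lambda>t. f t + g t) \<le> L1_norm f + L1_norm g"
proof -
  have "(LINT t|lborel. cmod (f t + g t)) \<le> (LINT t|lborel. cmod (f t) + cmod (g t))"
    using assms by (intro integral_mono) (auto simp: L1_def norm_triangle_ineq)
  then show ?thesis using assms by (simp add: L1_norm_def L1_def)
qed

lemma L1_norm_diff_le:
  assumes "f \<in> L1" "g \<in> L1"
  shows "L1_norm (\<lambda>t. f t - g t) \<le> L1_norm f + L1_norm g"
  using L1_norm_add_le[of f "\<lambda>t. - g t"] assms
  by (simp add: L1_norm_def L1_def)

lemma transl_mod_nonneg: "0 \<le> transl_mod f s"
  by (simp add: transl_mod_def L1_norm_nonneg)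

lemma transl_mod_le: "f \<in> L1 \<Longrightarrow> transl_mod f s \<le> 2 * L1_norm f"
  using L1_norm_diff_le[OF L1_translate[of f s], of f]
  by (simp add: transl_mod_def L1_norm_translate)

lemma transl_mod_measurable [measurable]:
  assumes "f \<in> L1" shows "transl_mod f \<in> borel_measurable borel"
proof -
  have [measurable]: "f \<in> borel_measurable borel" using assms by (auto simp: L1_def)
  have "(\<lambda>s. LINT t|lborel. cmod (f (t - s) - f t)) \<in> borel_measurable borel"
    by measurable
  then show ?thesis by (simp add: transl_mod_def[abs_def] L1_norm_def)
qed

lemma transl_mod_triangle:
  assumes f: "f \<in> L1" and g: "g \<in> L1"
  shows "transl_mod f s \<le> transl_mod g s + 2 * L1_norm (\<lambda>t. f t - g t)"
proof -
  have d: "(\<lambda>t. f t - g t) \<in> L1" by (rule L1_diff[OF f g])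
  have "transl_mod f s = L1_norm (\<lambda>t. (g (t - s) - g t) + ((f (t - s) - g (t - s)) - (f t - g t)))"
    unfolding transl_mod_def by (rule arg_cong[of _ _ L1_norm]) (simp add: fun_eq_iff)
  also have "\<dots> \<le> transl_mod g s + transl_mod (\<lambda>t. f t - g t) s"
    unfolding transl_mod_def
    using L1_norm_add_le[OF L1_diff[OF L1_translate[OF g, of s] g]
        L1_diff[OF L1_translate[OF d, of s] d]] by simp
  finally show ?thesis using transl_mod_le[OF d, of s] by simp
qed

text \<open>
  The functions whose modulus of continuity vanishes at \<open>0\<close> form a closed set in \<open>L\<^sup>1\<close>,
  since the modulus is Lipschitz in the \<open>L\<^sup>1\<close> norm with constant \<open>2\<close>.
\<close>

lemma transl_mod_tendsto_approx:
  assumes f: "f \<in> L1" and X: "X \<longlonglongrightarrow> (0::real)"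
    and approx: "\<And>e. 0 < e \<Longrightarrow>
      \<exists>g\<in>L1. L1_norm (\<lambda>t. f t - g t) < e \<and> (\<lambda>n. transl_mod g (X n)) \<longlonglongrightarrow> 0"
  shows "(\<lambda>n. transl_mod f (X n)) \<longlonglongrightarrow> 0"
proof (rule LIMSEQ_I)
  fix r :: real assume "0 < r"
  then obtain g where g: "g \<in> L1" "L1_norm (\<lambda>t. f t - g t) < r / 4"
      "(\<lambda>n. transl_mod g (X n)) \<longlonglongrightarrow> 0"
    using approx[of "r/4"] by auto
  obtain N where N: "\<And>n. n \<ge> N \<Longrightarrow> norm (transl_mod g (X n) - 0) < r / 2"
    using LIMSEQ_D[OF g(3), of "r/2"] \<open>0 < r\<close> by auto
  show "\<exists>N. \<forall>n\<ge>N. norm (transl_mod f (X n) - 0) < r"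
  proof (intro exI allI impI)
    fix n assume "n \<ge> N"
    then show "norm (transl_mod f (X n) - 0) < r"
      using N[of n] transl_mod_triangle[OF f g(1), of "X n"] g(2) transl_mod_nonneg[of f "X n"]
      by simp
  qed
qed

lemma L1_indicator:
  "A \<in> sets borel \<Longrightarrow> emeasure lborel A < \<infinity> \<Longrightarrow> (\<lambda>t. indicator A t *\<^sub>R c) \<in> L1"
  unfolding L1_def by simp

text \<open>
  An indicator \<open>u\<close> and its translate have the same integral, so their \<open>L\<^sup>1\<close> distance is twice
  the integral of the positive part of \<open>u t - u (t - s)\<close>. When the set is open this positive part
  tends to \<open>0\<close> at every point, and it is dominated by \<open>u\<close>.
\<close>

lemma transl_mod_indicator_open:
  fixes U :: "real set"
  assumes U: "open U" "emeasure lborel U < \<infinity>" and X: "X \<longlonglongrightarrow> 0"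
  shows "(\<lambda>n. transl_mod (\<lambda>t. indicator U t *\<^sub>R c) (X n)) \<longlonglongrightarrow> 0"
proof -
  define u :: "real \<Rightarrow> real" where "u = indicator U"
  have u [measurable]: "u \<in> borel_measurable borel" using U(1) by (simp add: u_def)
  have iu: "integrable lborel u" using U by (simp add: u_def)
  have ius: "integrable lborel (\<lambda>t. u (t - s))" for s
    using lborel_integrable_real_affine[OF iu, of 1 "-s"] by simp
  have eq: "(LINT t|lborel. u (t - s)) = (LINT t|lborel. u t)" for s
    using lborel_integral_real_affine[of 1 u "-s"] by simp
  have mod: "transl_mod (\<lambda>t. indicator U t *\<^sub>R c) s = 2 * cmod c * (LINT t|lborel. max 0 (u t - u (t - s)))" for s
  proof -
    have im: "integrable lborel (\<lambda>t. max 0 (u t - u (t - s)))"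
      using iu ius[of s] by auto
    have "transl_mod (\<lambda>t. indicator U t *\<^sub>R c) s
        = (LINT t|lborel. cmod c * (2 * max 0 (u t - u (t - s)) + (u (t - s) - u t)))"
      unfolding transl_mod_def L1_norm_def u_def
      by (rule Bochner_Integration.integral_cong) (auto simp: indicator_def norm_mult)
    also have "\<dots> = cmod c * (2 * (LINT t|lborel. max 0 (u t - u (t - s))))"
      using im iu ius[of s] eq[of s] by simp
    finally show ?thesis by simp
  qed
  have "(\<lambda>n. LINT t|lborel. max 0 (u t - u (t - X n))) \<longlonglongrightarrow> (LINT (t::real)|lborel. (0::real))"
  proof (rule integral_dominated_convergence[where w=u])
    show "AE t in lborel. (\<lambda>n. max 0 (u t - u (t - X n))) \<longlonglongrightarrow> 0"
    proof (rule AE_I2)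
      fix t :: real
      have "eventually (\<lambda>n. max 0 (u t - u (t - X n)) = 0) sequentially"
      proof (cases "t \<in> U")
        case True
        have "(\<lambda>n. t - X n) \<longlonglongrightarrow> t - 0" by (intro tendsto_intros X)
        then have "eventually (\<lambda>n. t - X n \<in> U) sequentially"
          using U(1) True by (auto dest: topological_tendstoD)
        then show ?thesis by eventually_elim (simp add: u_def True)
      qed (simp add: u_def indicator_def)
      then show "(\<lambda>n. max 0 (u t - u (t - X n))) \<longlonglongrightarrow> 0"
        by (rule tendsto_eventually)
    qed
    show "AE t in lborel. norm (max 0 (u t - u (t - X n))) \<le> u t" for n
      by (rule AE_I2) (simp add: u_def indicator_def)
  qed (use iu in simp_all)
  then show ?thesis
    unfolding mod by (auto intro!: tendsto_eq_intros)
qed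

text \<open>
  Continuity of translations in \<open>L\<^sup>1\<close>. Outer regularity reduces measurable sets to open ones;
  sums and \<open>L\<^sup>1\<close> limits then give all integrable functions.
\<close>

lemma transl_mod_tendsto:
  assumes f: "f \<in> L1" and X: "X \<longlonglongrightarrow> 0"
  shows "(\<lambda>n. transl_mod f (X n)) \<longlonglongrightarrow> 0"
proof -
  have "integrable lborel f" using f by (simp add: L1_def)
  then show ?thesis
  proof (induction rule: integrable_induct)
    case (base A c)
    then have A: "A \<in> sets borel" "emeasure lborel A < \<infinity>" by auto
    show ?case
    proof (rule transl_mod_tendsto_approx[OF L1_indicator[OF A] X])
      fix e :: real assume e: "0 < e"
      define d where "d = e / (cmod c + 1)"
      have d: "0 < d" using e by (simp add: d_def add_nonneg_pos)
      obtain U where U: "open U" "A \<subseteq> U" "emeasure lborel (U - A) < ennreal d"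
        using outer_regular_lborel[of A d] A d by auto
      have UA: "emeasure lborel U = emeasure lborel (U - A) + emeasure lborel A"
        using A U by (subst plus_emeasure) (auto simp: Un_absorb2)
      have fin: "emeasure lborel U < \<infinity>" "emeasure lborel (U - A) < \<infinity>"
        using U(3) A(2) UA by (auto simp: less_top[symmetric] ) 
      have "L1_norm (\<lambda>t. indicator A t *\<^sub>R c - indicator U t *\<^sub>R c)
          = (LINT t|lborel. cmod c * indicator (U - A) t)"
        unfolding L1_norm_def
        by (rule Bochner_Integration.integral_cong) (use U(2) in \<open>auto simp: indicator_def\<close>)
      also have "\<dots> = cmod c * measure lborel (U - A)"
        using A U fin by simp
      also have "\<dots> \<le> cmod c * d"
        using U(3) d by (intro mult_left_mono) (auto simp: measure_def enn2real_leI)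
      also have "\<dots> < (cmod c + 1) * d"
        using d by simp
      also have "(cmod c + 1) * d = e"
        using add_nonneg_pos[of "cmod c" 1] by (simp add: d_def)
      finally show "\<exists>g\<in>L1. L1_norm (\<lambda>t. indicator A t *\<^sub>R c - g t) < e \<and>
          (\<lambda>n. transl_mod g (X n)) \<longlonglongrightarrow> 0"
        using L1_indicator[of U c] U(1) fin(1) transl_mod_indicator_open[OF U(1) fin(1) X]
        by (intro bexI[of _ "\<lambda>t. indicator U t *\<^sub>R c"]) auto
    qed
  next
    case (add f g)
    then have L: "f \<in> L1" "g \<in> L1" by (auto simp: L1_def)
    have "transl_mod (\<lambda>t. f t + g t) s \<le> transl_mod f s + transl_mod g s" for s
      unfolding transl_mod_def
      using L1_norm_add_le[OF L1_diff[OF L1_translate[OF L(1), of s] L(1)] L1_diff[OF L1_translate[OF L(2), of s] L(2)]]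
      by (simp add: algebra_simps)
    then have le: "\<forall>n. transl_mod (\<lambda>t. f t + g t) (X n) \<le> transl_mod f (X n) + transl_mod g (X n)"
      by blast
    have "(\<lambda>n. transl_mod f (X n) + transl_mod g (X n)) \<longlonglongrightarrow> 0"
      using tendsto_add[OF add(3) add(4)] by simp
    from tendsto_sandwich[OF _ _ tendsto_const this] show ?case
      using le by (simp add: transl_mod_nonneg)
  next
    case (lim f S)
    show ?case
    proof (rule transl_mod_tendsto_approx)
      show "f \<in> L1" using lim(4) by (simp add: L1_def)
      show "X \<longlonglongrightarrow> 0" by fact
      fix e :: real assume e: "0 < e"
      have "(\<lambda>i. LINT t|lborel. cmod (f t - S i t)) \<longlonglongrightarrow> (LINT (t::real)|lborel. (0::real))"
      proof (rule integral_dominated_convergence[where w="\<lambda>t. 3 * cmod (f t)"])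
        show "AE t in lborel. (\<lambda>i. cmod (f t - S i t)) \<longlonglongrightarrow> 0"
        proof (rule AE_I2)
          fix t :: real
          have "(\<lambda>i. cmod (f t - S i t)) \<longlonglongrightarrow> cmod (f t - f t)"
            using lim(2) by (intro tendsto_intros) simp
          then show "(\<lambda>i. cmod (f t - S i t)) \<longlonglongrightarrow> 0" by simp
        qed
        show "AE t in lborel. norm (cmod (f t - S i t)) \<le> 3 * cmod (f t)" for i
        proof (rule AE_I2)
          fix t :: real
          show "norm (cmod (f t - S i t)) \<le> 3 * cmod (f t)"
            using norm_triangle_ineq4[of "f t" "S i t"] lim(3)[of t i] by simp
        qed
      qed (use lim in auto)
      then have "(\<lambda>i. L1_norm (\<lambda>t. f t - S i t)) \<longlonglongrightarrow> 0"
        by (simp add: L1_norm_def)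
      from LIMSEQ_D[OF this e] obtain i where "L1_norm (\<lambda>t. f t - S i t) < e"
        by (auto simp: L1_norm_nonneg)
      then show "\<exists>g\<in>L1. L1_norm (\<lambda>t. f t - g t) < e \<and> (\<lambda>n. transl_mod g (X n)) \<longlonglongrightarrow> 0"
        using lim(1,5) by (intro bexI[of _ "S i"]) (auto simp: L1_def)
    qed
  qed
qed

section \<open>Convolution, modulation and dilation\<close>

lemma convolution_integrable_pair:
  assumes f: "f \<in> L1" and g: "g \<in> L1"
  shows "integrable (lborel \<Otimes>\<^sub>M lborel) (\<lambda>(s, t). f s * g (t - s))"
proof (rule lborel_pair.Fubini_integrable)
  have [measurable]: "f \<in> borel_measurable borel" "g \<in> borel_measurable borel"
    using f g by (auto simp: L1_def)
  show "(\<lambda>(s, t). f s * g (t - s)) \<in> borel_measurable (lborel \<Otimes>\<^sub>M lborel)"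
    by measurable
  have "(LINT t|lborel. norm (case (s, t) of (s, t) \<Rightarrow> f s * g (t - s))) = cmod (f s) * L1_norm g" for s
    using L1_norm_translate[of g s] by (simp add: norm_mult L1_norm_def)
  then show "integrable lborel (\<lambda>s. LINT t|lborel. norm (case (s, t) of (s, t) \<Rightarrow> f s * g (t - s)))"
    using f by (simp add: L1_def)
  show "AE s in lborel. integrable lborel (\<lambda>t. case (s, t) of (s, t) \<Rightarrow> f s * g (t - s))"
    using L1_translate[OF g] by (simp add: L1_def)
qed

lemma convolution_L1: "f \<in> L1 \<Longrightarrow> g \<in> L1 \<Longrightarrow> convolution f g \<in> L1"
  using lborel_pair.integrable_snd[OF convolution_integrable_pair[of f g]]
  by (simp add: L1_def convolution_def[abs_def])

definition modulate :: "real \<Rightarrow> (real \<Rightarrow> complex) \<Rightarrow> real \<Rightarrow> complex" where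
  "modulate c f = (\<lambda>t. f t * exp (\<i> * of_real t * of_real c))"

lemma cmod_exp_ii [simp]:
  "cmod (exp (\<i> * complex_of_real t * complex_of_real x)) = 1"
  "cmod (exp (- (\<i> * complex_of_real t * complex_of_real x))) = 1"
  using norm_exp_i_times[of "t * x"] norm_exp_i_times[of "- (t * x)"]
  by (simp_all add: mult.assoc)

lemma modulate_L1: "f \<in> L1 \<Longrightarrow> modulate c f \<in> L1"
  unfolding L1_def modulate_def
  by (auto intro!: Bochner_Integration.integrable_bound[of _ f] simp: norm_mult)

lemma L1_norm_modulate: "L1_norm (modulate c f) = L1_norm f"
  by (simp add: L1_norm_def modulate_def norm_mult)

text \<open>
  Through this identity and the compatibility of modulation with convolution, statements about
  the transform at \<open>\<xi>\<close> reduce to statements about integrals.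
\<close>

lemma fourier_eq_integral_modulate: "fourier f \<xi> = (LINT t|lborel. modulate (- \<xi>) f t)"
  by (simp add: fourier_def modulate_def)

lemma modulate_modulate: "modulate a (modulate b f) = modulate (a + b) f"
  by (simp add: modulate_def fun_eq_iff distrib_left exp_add mult_ac)

lemma fourier_modulate: "fourier (modulate c f) \<xi> = fourier f (\<xi> - c)"
  by (simp add: fourier_eq_integral_modulate modulate_modulate)

lemma convolution_modulate:
  "convolution (modulate c f) (modulate c g) = modulate c (convolution f g)"
proof
  fix t
  have E: "f s * exp (\<i> * of_real s * of_real c) * (g (t - s) * exp (\<i> * of_real (t - s) * of_real c))
      = f s * g (t - s) * exp (\<i> * of_real t * of_real c)" for s
    by (simp add: exp_add[symmetric] algebra_simps)
  then show "convolution (modulate c f) (modulate c g) t = modulate c (convolution f g) t"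
    by (simp only: convolution_def modulate_def E integral_mult_left_zero)
qed

lemma integral_convolution:
  assumes f: "f \<in> L1" and g: "g \<in> L1"
  shows "(LINT t|lborel. convolution f g t) = (LINT t|lborel. f t) * (LINT t|lborel. g t)"
proof -
  have eq: "(LINT t|lborel. g (t - s)) = (LINT t|lborel. g t)" for s
    using lborel_integral_real_affine[of 1 g "-s"] by simp
  have "(LINT t|lborel. convolution f g t) = (LINT s|lborel. LINT t|lborel. f s * g (t - s))"
    unfolding convolution_def
    by (rule lborel_pair.Fubini_integral[OF convolution_integrable_pair[OF f g]])
  also have "\<dots> = (LINT s|lborel. f s * (LINT t|lborel. g t))"
    by (simp add: eq)
  finally show ?thesis by simp
qed

lemma fourier_convolution:
  assumes "f \<in> L1" "g \<in> L1"
  shows "fourier (convolution f g) \<xi> = fourier f \<xi> * fourier g \<xi>"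
  by (simp add: fourier_eq_integral_modulate convolution_modulate[symmetric]
      integral_convolution modulate_L1 assms)

lemma fourier_diff:
  assumes "f \<in> L1" "g \<in> L1"
  shows "fourier (\<lambda>t. f t - g t) \<xi> = fourier f \<xi> - fourier g \<xi>"
  using modulate_L1[OF assms(1), of "-\<xi>"] modulate_L1[OF assms(2), of "-\<xi>"]
  by (simp add: fourier_eq_integral_modulate modulate_def L1_def algebra_simps)

lemma fourier_cmult: "fourier (\<lambda>t. c * f t) \<xi> = c * fourier f \<xi>"
  by (simp add: fourier_def mult.assoc)

lemma continuous_fourier:
  assumes "f \<in> L1"
  shows "continuous_on UNIV (fourier f)"
proof -
  have [measurable]: "f \<in> borel_measurable borel" using assms by (auto simp: L1_def)
  have "(\<lambda>n. fourier f (X n)) \<longlonglongrightarrow> fourier f a" if "X \<longlonglongrightarrow> a" for X a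
    unfolding fourier_def
    by (rule integral_dominated_convergence[where w="\<lambda>t. cmod (f t)"])
      (use assms that in \<open>auto simp: L1_def norm_mult intro!: tendsto_intros\<close>)
  then show ?thesis
    by (auto simp: continuous_on_sequentially comp_def)
qed

text \<open>
  Since \<open>fourier g 0\<close> is the integral of \<open>g\<close>, the difference at \<open>t\<close> is the integral of
  \<open>g s * (f (t - s) - f t)\<close> over \<open>s\<close>; take norms and exchange the integrals.
\<close>

lemma L1_norm_convolution_diff_le:
  assumes g: "g \<in> L1" and f: "f \<in> L1"
  shows "L1_norm (\<lambda>t. convolution g f t - fourier g 0 * f t)
    \<le> (LINT s|lborel. cmod (g s) * transl_mod f s)"
proof -
  have [measurable]: "f \<in> borel_measurable borel" "g \<in> borel_measurable borel"
    using f g by (auto simp: L1_def)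
  let ?F = "\<lambda>(s, t). cmod (g s) * cmod (f (t - s) - f t)"
  have ig: "integrable lborel (\<lambda>s. cmod (g s) * transl_mod f s)"
  proof (rule Bochner_Integration.integrable_bound)
    show "integrable lborel (\<lambda>s. (2 * L1_norm f) * cmod (g s))"
      using g by (simp add: L1_def)
    show "(\<lambda>s. cmod (g s) * transl_mod f s) \<in> borel_measurable lborel"
      using f by measurable
    show "AE s in lborel. norm (cmod (g s) * transl_mod f s) \<le> norm (2 * L1_norm f * cmod (g s))"
      using transl_mod_le[OF f]
      by (auto simp: abs_mult transl_mod_nonneg L1_norm_nonneg mult.commute[of _ "cmod _"]
          intro!: mult_left_mono)
  qed
  have iF: "integrable (lborel \<Otimes>\<^sub>M lborel) ?F"
  proof (rule lborel_pair.Fubini_integrable)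
    show "?F \<in> borel_measurable (lborel \<Otimes>\<^sub>M lborel)" by measurable
    show "integrable lborel (\<lambda>s. LINT t|lborel. norm (?F (s, t)))"
      using ig by (simp add: transl_mod_def L1_norm_def)
    show "AE s in lborel. integrable lborel (\<lambda>t. ?F (s, t))"
      using L1_diff[OF L1_translate[OF f] f] by (simp add: L1_def)
  qed
  have le: "AE t in lborel. cmod (convolution g f t - fourier g 0 * f t)
      \<le> (LINT s|lborel. cmod (g s) * cmod (f (t - s) - f t))"
    using lborel_pair.AE_integrable_snd[OF convolution_integrable_pair[OF g f]]
  proof eventually_elim
    case (elim t)
    have "convolution g f t - fourier g 0 * f t = (LINT s|lborel. g s * (f (t - s) - f t))"
      using elim g by (simp add: convolution_def fourier_def L1_def right_diff_distrib)
    then show ?case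
      using integral_norm_bound[of lborel "\<lambda>s. g s * (f (t - s) - f t)"]
      by (simp add: norm_mult)
  qed
  have "L1_norm (\<lambda>t. convolution g f t - fourier g 0 * f t)
      \<le> (LINT t|lborel. LINT s|lborel. cmod (g s) * cmod (f (t - s) - f t))"
    unfolding L1_norm_def
  proof (rule integral_mono_AE[OF _ _ le])
    show "integrable lborel (\<lambda>t. cmod (convolution g f t - fourier g 0 * f t))"
      using L1_diff[OF convolution_L1[OF g f] L1_cmult[OF f]] by (simp add: L1_def)
    show "integrable lborel (\<lambda>t. LINT s|lborel. cmod (g s) * cmod (f (t - s) - f t))"
      using lborel_pair.integrable_snd[OF iF] .
  qed
  also have "\<dots> = (LINT s|lborel. LINT t|lborel. cmod (g s) * cmod (f (t - s) - f t))"
    by (rule lborel_pair.Fubini_integral[OF iF])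
  finally show ?thesis
    by (simp add: transl_mod_def L1_norm_def)
qed

text \<open>
  The common core of the two limits below: dilating either factor of a convolution turns the bound
  of \<open>L1_norm_convolution_diff_le\<close> into this integral.
\<close>

lemma weighted_transl_mod_tendsto:
  assumes g: "g \<in> L1" and f: "f \<in> L1" and X: "X \<longlonglongrightarrow> 0"
  shows "(\<lambda>n. LINT s|lborel. cmod (g s) * transl_mod f (X n * s)) \<longlonglongrightarrow> 0"
proof -
  have [measurable]: "f \<in> borel_measurable borel" "g \<in> borel_measurable borel"
    "transl_mod f \<in> borel_measurable borel"
    using f g by (auto simp: L1_def)
  have "(\<lambda>n. LINT s|lborel. cmod (g s) * transl_mod f (X n * s)) \<longlonglongrightarrow> (LINT (s::real)|lborel. (0::real))"
  proof (rule integral_dominated_convergence[where w="\<lambda>s. (2 * L1_norm f) * cmod (g s)"])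
    show "integrable lborel (\<lambda>s. (2 * L1_norm f) * cmod (g s))"
      using g by (simp add: L1_def)
    show "AE s in lborel. (\<lambda>n. cmod (g s) * transl_mod f (X n * s)) \<longlonglongrightarrow> 0"
    proof (rule AE_I2)
      fix s
      have "(\<lambda>n. X n * s) \<longlonglongrightarrow> 0" using tendsto_mult_right[OF X, of s] by simp
      from tendsto_mult_left[OF transl_mod_tendsto[OF f this], of "cmod (g s)"]
      show "(\<lambda>n. cmod (g s) * transl_mod f (X n * s)) \<longlonglongrightarrow> 0" by simp
    qed
    show "AE s in lborel. norm (cmod (g s) * transl_mod f (X n * s)) \<le> 2 * L1_norm f * cmod (g s)" for n
      using transl_mod_le[OF f]
      by (auto simp: abs_mult transl_mod_nonneg L1_norm_nonneg mult.commute[of _ "cmod _"]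
          intro!: mult_left_mono)
  qed auto
  then show ?thesis by simp
qed

text \<open>
  The normalisation keeps the \<open>L\<^sup>1\<close> norm, and stretches the Fourier transform by the factor \<open>a\<close>.
\<close>

definition dilate :: "real \<Rightarrow> (real \<Rightarrow> complex) \<Rightarrow> real \<Rightarrow> complex" where
  "dilate a f = (\<lambda>t. of_real a * f (a * t))"

lemma dilate_L1: "f \<in> L1 \<Longrightarrow> 0 < a \<Longrightarrow> dilate a f \<in> L1"
  using lborel_integrable_real_affine[of f a 0] by (simp add: L1_def dilate_def)

lemma L1_norm_dilate: "0 < a \<Longrightarrow> L1_norm (dilate a f) = L1_norm f"
  using lborel_integral_real_affine[of a "\<lambda>t. cmod (f t)" 0]
  by (simp add: L1_norm_def dilate_def norm_mult)

lemma fourier_dilate: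
  assumes "0 < a"
  shows "fourier (dilate a f) \<xi> = fourier f (\<xi> / a)"
  using lborel_integral_real_affine[of a "\<lambda>t. f t * exp (- (\<i> * of_real t * of_real (\<xi> / a)))" 0] assms
  by (simp add: fourier_def dilate_def scaleR_conv_of_real mult.assoc)

lemma transl_mod_dilate:
  assumes "0 < a"
  shows "transl_mod (dilate a f) s = transl_mod f (a * s)"
  using L1_norm_dilate[OF assms, of "\<lambda>t. f (t - a * s) - f t"]
  by (simp add: transl_mod_def dilate_def right_diff_distrib)

text \<open>
  A strongly stretched \<open>f\<close> varies so little on the scale of \<open>g\<close> that convolution with \<open>g\<close> only
  multiplies it by the integral of \<open>g\<close>; on the Fourier side, \<open>fourier g\<close> is almost constant on
  the shrinking set where the transform of the dilated \<open>f\<close> lives.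
\<close>

lemma convolution_dilate_narrow_tendsto:
  assumes g: "g \<in> L1" and f: "f \<in> L1" and X: "X \<longlonglongrightarrow> 0" "\<And>n. 0 < X n"
  shows "(\<lambda>n. L1_norm (\<lambda>t. convolution g (dilate (X n) f) t - fourier g 0 * dilate (X n) f t)) \<longlonglongrightarrow> 0"
proof (rule tendsto_sandwich[OF _ _ tendsto_const])
  show "(\<lambda>n. LINT s|lborel. cmod (g s) * transl_mod f (X n * s)) \<longlonglongrightarrow> 0"
    by (rule weighted_transl_mod_tendsto[OF g f X(1)])
  show "\<forall>\<^sub>F n in sequentially. L1_norm (\<lambda>t. convolution g (dilate (X n) f) t - fourier g 0 * dilate (X n) f t)
      \<le> (LINT s|lborel. cmod (g s) * transl_mod f (X n * s))"
    using L1_norm_convolution_diff_le[OF g dilate_L1[OF f X(2)]] transl_mod_dilate[OF X(2)]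
    by simp
qed (simp add: L1_norm_nonneg)

text \<open>
  The dilates of \<open>g\<close> concentrate at \<open>0\<close>: an approximate identity, up to the factor \<open>fourier g 0\<close>.
\<close>

lemma convolution_dilate_wide_tendsto:
  assumes g: "g \<in> L1" and f: "f \<in> L1" and X: "X \<longlonglongrightarrow> 0" "\<And>n. 0 < X n"
  shows "(\<lambda>n. L1_norm (\<lambda>t. convolution (dilate (1 / X n) g) f t - fourier g 0 * f t)) \<longlonglongrightarrow> 0"
proof (rule tendsto_sandwich[OF _ _ tendsto_const])
  show "(\<lambda>n. LINT s|lborel. cmod (g s) * transl_mod f (X n * s)) \<longlonglongrightarrow> 0"
    by (rule weighted_transl_mod_tendsto[OF g f X(1)])
  have "(LINT s|lborel. cmod (dilate (1 / X n) g s) * transl_mod f s)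
      = (LINT s|lborel. cmod (g s) * transl_mod f (X n * s))" for n
    using lborel_integral_real_affine[of "X n" "\<lambda>s. cmod (dilate (1 / X n) g s) * transl_mod f s" 0]
      X(2)[of n]
    by (simp add: dilate_def norm_mult norm_divide mult.assoc)
  then show "\<forall>\<^sub>F n in sequentially. L1_norm (\<lambda>t. convolution (dilate (1 / X n) g) f t - fourier g 0 * f t)
      \<le> (LINT s|lborel. cmod (g s) * transl_mod f (X n * s))"
    using L1_norm_convolution_diff_le[OF dilate_L1[OF g, of "1 / X _"] f] X(2)
    by (simp add: fourier_dilate)
qed (simp add: L1_norm_nonneg)

section \<open>Uniqueness of the Fourier transform\<close>

text \<open>
  The multiplication formula, obtained by exchanging two integrals, with an affine substitution
  that covers dilated and translated kernels.
\<close>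

lemma integral_fourier_affine:
  assumes f: "f \<in> L1" and g: "g \<in> L1"
  shows "(LINT u|lborel. fourier g (b + a * u) * f u)
    = (LINT x|lborel. modulate (- b) g x * fourier f (a * x))"
proof -
  have [measurable]: "f \<in> borel_measurable borel" "g \<in> borel_measurable borel"
    using f g by (auto simp: L1_def)
  let ?F = "\<lambda>(x, u). g x * exp (- (\<i> * of_real x * of_real (b + a * u))) * f u"
  have iF: "integrable (lborel \<Otimes>\<^sub>M lborel) ?F"
  proof (rule lborel_pair.Fubini_integrable)
    show "?F \<in> borel_measurable (lborel \<Otimes>\<^sub>M lborel)" by measurable
    show "integrable lborel (\<lambda>x. LINT u|lborel. norm (?F (x, u)))"
      using g by (simp add: norm_mult L1_def del: of_real_add of_real_mult)
    have "integrable lborel (\<lambda>u. exp (- (\<i> * of_real x * of_real (b + a * u))) * f u)" for x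
      by (rule Bochner_Integration.integrable_bound[of _ f])
        (use f in \<open>auto simp: norm_mult L1_def simp del: of_real_add of_real_mult\<close>)
    then show "AE x in lborel. integrable lborel (\<lambda>u. ?F (x, u))"
      by (simp add: mult.assoc)
  qed
  have "(LINT u|lborel. fourier g (b + a * u) * f u)
      = (LINT u|lborel. LINT x|lborel. g x * exp (- (\<i> * of_real x * of_real (b + a * u))) * f u)"
    by (simp add: fourier_def)
  also have "\<dots> = (LINT x|lborel. LINT u|lborel. g x * exp (- (\<i> * of_real x * of_real (b + a * u))) * f u)"
    by (rule lborel_pair.Fubini_integral[OF iF])
  also have "\<dots> = (LINT x|lborel. modulate (- b) g x * fourier f (a * x))"
  proof (rule Bochner_Integration.integral_cong[OF refl])
    fix x
    have "(LINT u|lborel. g x * exp (- (\<i> * of_real x * of_real (b + a * u))) * f u)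
        = (LINT u|lborel. modulate (- b) g x * (f u * exp (- (\<i> * of_real u * of_real (a * x)))))"
      by (rule Bochner_Integration.integral_cong[OF refl])
        (simp add: modulate_def exp_add[symmetric] algebra_simps exp_diff exp_minus divide_inverse)
    then show "(LINT u|lborel. g x * exp (- (\<i> * of_real x * of_real (b + a * u))) * f u)
        = modulate (- b) g x * fourier f (a * x)"
      by (simp only: fourier_def integral_mult_right_zero)
  qed
  finally show ?thesis .
qed

definition gauss :: "real \<Rightarrow> complex" where
  "gauss t = of_real (std_normal_density t)"

lemma gauss_L1: "gauss \<in> L1"
  unfolding L1_def gauss_def[abs_def]
  using integrable_std_normal_moment[of 0] by simp

lemma fourier_gauss: "fourier gauss \<xi> = of_real (exp (- \<xi>\<^sup>2 / 2))"
proof -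
  have "fourier gauss \<xi> = char std_normal_distribution (- \<xi>)"
    unfolding fourier_def char_def gauss_def
    by (subst integral_density) (auto simp: scaleR_conv_of_real mult_ac normal_density_nonneg)
  then show ?thesis by (simp add: char_std_normal_distribution)
qed

text \<open>
  The Gaussian is a multiple of its own transform. Convolution with it can therefore be rewritten, by
  the multiplication formula, in terms of the transform of the other factor.
\<close>

lemma gauss_eq_fourier: "gauss t = fourier gauss (- t) / of_real (sqrt (2 * pi))"
  unfolding fourier_gauss by (simp add: gauss_def normal_density_def)

text \<open>
  Uniqueness: all Gaussian means of \<open>f\<close> are determined by its transform, hence vanish, and they
  converge to \<open>f\<close> in \<open>L\<^sup>1\<close>.
\<close>

lemma L1_norm_eq_0_if_fourier_0:
  assumes f: "f \<in> L1" and zero: "\<And>\<xi>. fourier f \<xi> = 0"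
  shows "L1_norm f = 0"
proof -
  have conv: "convolution (dilate a gauss) f t = 0" if "0 < a" for a t
  proof -
    have "convolution (dilate a gauss) f t = (LINT u|lborel. dilate a gauss (t - u) * f u)"
      unfolding convolution_def
      using lborel_integral_real_affine[of "-1" "\<lambda>u. dilate a gauss (t - u) * f u" t] by simp
    also have "\<dots> = (LINT u|lborel. (of_real (a / sqrt (2 * pi)))
        * (fourier gauss (- (a * t) + a * u) * f u))"
      by (rule Bochner_Integration.integral_cong[OF refl])
        (simp add: dilate_def gauss_eq_fourier[of "a * t - a * _"] right_diff_distrib)
    also have "\<dots> = of_real (a / sqrt (2 * pi)) * (LINT u|lborel. fourier gauss (- (a * t) + a * u) * f u)"
      by (rule integral_mult_right_zero)
    also have "\<dots> = 0"
      unfolding integral_fourier_affine[OF f gauss_L1] zero by simp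
    finally show ?thesis .
  qed
  have "(\<lambda>n. L1_norm (\<lambda>t. convolution (dilate (1 / inverse (real (Suc n))) gauss) f t
      - fourier gauss 0 * f t)) \<longlonglongrightarrow> 0"
    by (rule convolution_dilate_wide_tendsto[OF gauss_L1 f LIMSEQ_inverse_real_of_nat]) simp
  then have "(\<lambda>n::nat. L1_norm f) \<longlonglongrightarrow> 0"
    by (simp add: conv fourier_gauss L1_norm_def)
  then show ?thesis
    by (simp add: LIMSEQ_const_iff)
qed

section \<open>A kernel with trapezoidal Fourier transform\<close>

text \<open>
  A multiple of the Fejer kernel. The value at \<open>0\<close> is \<open>0\<close> by the convention on division, not the
  limit \<open>1 / 2\<close>; this affects a null set only.
\<close>

definition cos_kernel :: "real \<Rightarrow> real" where
  "cos_kernel t = (1 - cos t) / t\<^sup>2"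

lemma integrable_cos_kernel: "integrable lborel cos_kernel"
proof (rule Bochner_Integration.integrable_bound)
  have "set_integrable lborel (einterval (-\<infinity>) \<infinity>) (\<lambda>x. inverse (1 + x\<^sup>2))"
    by (rule integrable_inverse_1_plus_square)
  then have "integrable lborel (\<lambda>x::real. inverse (1 + x\<^sup>2))"
    by (simp add: set_integrable_def)
  then show "integrable lborel (\<lambda>x::real. 4 * inverse (1 + x\<^sup>2))"
    by simp
  show "cos_kernel \<in> borel_measurable lborel"
    unfolding cos_kernel_def[abs_def] by measurable
  show "AE t in lborel. norm (cos_kernel t) \<le> norm (4 * inverse (1 + t\<^sup>2))"
  proof (rule AE_I2)
    fix t :: real
    have "1 - cos t \<le> t\<^sup>2 / 2"
      using cos_double_sin[of "t / 2"] power_mono[OF abs_sin_x_le_abs_x[of "t / 2"], of 2]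
      by (simp add: power_divide)
    moreover have "(1 - cos t) * t\<^sup>2 \<le> 2 * t\<^sup>2"
      using cos_ge_minus_one[of t] by (intro mult_right_mono) auto
    ultimately have "(1 - cos t) + (1 - cos t) * t\<^sup>2 \<le> t\<^sup>2 / 2 + 2 * t\<^sup>2"
      by (rule add_mono)
    also have "\<dots> \<le> 4 * t\<^sup>2" by simp
    finally have "(1 - cos t) * (1 + t\<^sup>2) \<le> 4 * t\<^sup>2"
      by (simp add: distrib_left)
    then have "t \<noteq> 0 \<Longrightarrow> (1 - cos t) / t\<^sup>2 \<le> 4 / (1 + t\<^sup>2)"
      by (simp add: divide_simps add_pos_nonneg)
    then show "norm (cos_kernel t) \<le> norm (4 * inverse (1 + t\<^sup>2))"
      by (cases "t = 0") (simp_all add: cos_kernel_def divide_inverse)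
  qed
qed

definition cos_kernel_mass :: real where
  "cos_kernel_mass = (LINT t|lborel. cos_kernel t)"

lemma cos_kernel_mass_pos: "0 < cos_kernel_mass"
proof -
  \<comment> \<open>a lower bound for the integrand on \<open>[1, 2]\<close>\<close>
  have "0 < (1 - cos 1) / (4::real)"
    using cos_monotone_0_pi[of 0 1] pi_gt3 by simp
  also have "(1 - cos 1) / 4 = (LINT t|lborel. (1 - cos 1) / (4::real) * indicator {1..2::real} t)"
    by simp
  also have "\<dots> \<le> (LINT t|lborel. cos_kernel t)"
  proof (rule integral_mono)
    fix t :: real
    show "(1 - cos 1) / 4 * indicator {1..2} t \<le> cos_kernel t"
    proof (cases "t \<in> {1..2}")
      case True
      have "cos t \<le> cos 1"
        using True pi_gt3 by (intro cos_monotone_0_pi_le) auto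
      moreover have "t\<^sup>2 \<le> 4" using power_mono[of t 2 2] True by simp
      ultimately have "(1 - cos 1) / 4 \<le> (1 - cos t) / t\<^sup>2"
        using True by (intro frac_le) auto
      then show ?thesis using True by (simp add: cos_kernel_def)
    qed (simp add: cos_kernel_def)
  qed (auto simp: integrable_cos_kernel)
  finally show ?thesis by (simp add: cos_kernel_mass_def)
qed

text \<open>
  The substitution of \<open>a * t\<close> for \<open>t\<close> reduces to the case \<open>a = 1\<close>. The absolute value that appears here is
  the source of the piecewise linear Fourier transform below.
\<close>

lemma has_integral_one_minus_cos:
  "has_bochner_integral lborel (\<lambda>t. (1 - cos (a * t)) / t\<^sup>2) (\<bar>a\<bar> * cos_kernel_mass)"
proof (cases "a = 0")
  case True
  then show ?thesis by (simp add: has_bochner_integral_zero)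
next
  case False
  have "has_bochner_integral lborel cos_kernel cos_kernel_mass"
    using integrable_cos_kernel by (simp add: has_bochner_integral_iff cos_kernel_mass_def)
  then have "has_bochner_integral lborel (\<lambda>t. cos_kernel (0 + a * t)) (cos_kernel_mass /\<^sub>R \<bar>a\<bar>)"
    by (subst (asm) lborel_has_bochner_integral_real_affine_iff[OF False])
  from has_bochner_integral_mult_right[OF this, of "a\<^sup>2"]
  have "has_bochner_integral lborel (\<lambda>t. a\<^sup>2 * cos_kernel (a * t)) (a\<^sup>2 * (cos_kernel_mass / \<bar>a\<bar>))"
    by (simp add: divide_inverse mult_ac)
  moreover have "a\<^sup>2 * cos_kernel (a * t) = (1 - cos (a * t)) / t\<^sup>2" for t
    using False by (simp add: cos_kernel_def power_mult_distrib)
  moreover have "a\<^sup>2 * (cos_kernel_mass / \<bar>a\<bar>) = \<bar>a\<bar> * cos_kernel_mass"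
    using False by (cases "0 < a") (auto simp: power2_eq_square)
  ultimately show ?thesis by simp
qed

text \<open>
  A de la Vallee Poussin kernel, normalised so that its transform is \<open>1\<close> on \<open>[-1, 1]\<close>.
\<close>

definition trap_kernel_real :: "real \<Rightarrow> real" where
  "trap_kernel_real t = (cos t - cos (2 * t)) / (cos_kernel_mass * t\<^sup>2)"

definition trap_kernel :: "real \<Rightarrow> complex" where
  "trap_kernel t = of_real (trap_kernel_real t)"

text \<open>
  Product-to-sum formulas turn the integrand into a combination of the functions
  \<open>(1 - cos (a * t)) / t\<^sup>2\<close>, whose integrals are proportional to \<open>\<bar>a\<bar>\<close>. The value is a trapezoid: \<open>1\<close> for
  \<open>\<bar>\<xi>\<bar> \<le> 1\<close>, and \<open>0\<close> for \<open>\<bar>\<xi>\<bar> \<ge> 2\<close>.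
\<close>

lemma trap_kernel_real_cos:
  "has_bochner_integral lborel (\<lambda>t. trap_kernel_real t * cos (t * \<xi>))
     ((\<bar>2 + \<xi>\<bar> + \<bar>2 - \<xi>\<bar> - \<bar>1 + \<xi>\<bar> - \<bar>1 - \<xi>\<bar>) / 2)"
proof -
  let ?G = "\<lambda>a t. (1 - cos (a * t)) / t\<^sup>2"
  let ?F = "\<lambda>t. (?G (2 + \<xi>) t + ?G (2 - \<xi>) t - ?G (1 + \<xi>) t - ?G (1 - \<xi>) t) / (2 * cos_kernel_mass)"
  have "has_bochner_integral lborel ?F
      ((\<bar>2 + \<xi>\<bar> * cos_kernel_mass + \<bar>2 - \<xi>\<bar> * cos_kernel_mass
        - \<bar>1 + \<xi>\<bar> * cos_kernel_mass - \<bar>1 - \<xi>\<bar> * cos_kernel_mass) / (2 * cos_kernel_mass))"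
    by (intro has_bochner_integral_divide_zero has_bochner_integral_add has_bochner_integral_diff
        has_integral_one_minus_cos)
  also have "?F = (\<lambda>t. trap_kernel_real t * cos (t * \<xi>))"
  proof
    fix t
    have "cos ((1 + \<xi>) * t) + cos ((1 - \<xi>) * t) = 2 * cos t * cos (t * \<xi>)"
      "cos ((2 + \<xi>) * t) + cos ((2 - \<xi>) * t) = 2 * cos (2 * t) * cos (t * \<xi>)"
      by (simp_all add: algebra_simps cos_add cos_diff)
    then have "?F t = (2 * cos t * cos (t * \<xi>) - 2 * cos (2 * t) * cos (t * \<xi>)) / t\<^sup>2 / (2 * cos_kernel_mass)"
      by (simp add: add_divide_distrib[symmetric] diff_divide_distrib[symmetric])
    also have "\<dots> = trap_kernel_real t * cos (t * \<xi>)"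
      by (simp add: trap_kernel_real_def diff_divide_distrib left_diff_distrib right_diff_distrib mult_ac)
    finally show "?F t = trap_kernel_real t * cos (t * \<xi>)" .
  qed
  also have "(\<bar>2 + \<xi>\<bar> * cos_kernel_mass + \<bar>2 - \<xi>\<bar> * cos_kernel_mass
        - \<bar>1 + \<xi>\<bar> * cos_kernel_mass - \<bar>1 - \<xi>\<bar> * cos_kernel_mass) / (2 * cos_kernel_mass)
      = (\<bar>2 + \<xi>\<bar> + \<bar>2 - \<xi>\<bar> - \<bar>1 + \<xi>\<bar> - \<bar>1 - \<xi>\<bar>) / 2"
    using cos_kernel_mass_pos by (simp add: field_simps)
  finally show ?thesis .
qed

lemma trap_kernel_L1: "trap_kernel \<in> L1"
  using trap_kernel_real_cos[of 0]
  by (simp add: L1_def trap_kernel_def[abs_def] has_bochner_integral_iff)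

lemma fourier_trap_kernel:
  "fourier trap_kernel \<xi> = of_real ((\<bar>2 + \<xi>\<bar> + \<bar>2 - \<xi>\<bar> - \<bar>1 + \<xi>\<bar> - \<bar>1 - \<xi>\<bar>) / 2)"
proof -
  have i: "integrable lborel (\<lambda>t. trap_kernel t * exp (- (\<i> * of_real t * of_real \<xi>)))"
    using modulate_L1[OF trap_kernel_L1, of "- \<xi>"] by (simp add: modulate_def L1_def)
  have E: "exp (- (\<i> * of_real t * of_real \<xi>)) = Complex (cos (t * \<xi>)) (- sin (t * \<xi>))" for t
    using cis_conv_exp[of "- (t * \<xi>)"] by (simp add: mult.assoc complex_eq_iff)
  have "Re (fourier trap_kernel \<xi>) = (LINT t|lborel. trap_kernel_real t * cos (t * \<xi>))"
    unfolding fourier_def using i by (simp add: integral_Re[symmetric] trap_kernel_def E)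
  moreover have "Im (fourier trap_kernel \<xi>) = (LINT t|lborel. - (trap_kernel_real t * sin (t * \<xi>)))"
    unfolding fourier_def using i by (simp add: integral_Im[symmetric] trap_kernel_def E)
  moreover have "(LINT t|lborel. trap_kernel_real t * sin (t * \<xi>)) = 0"
    using lborel_integral_real_affine[of "-1" "\<lambda>t. trap_kernel_real t * sin (t * \<xi>)" 0]
    by (simp add: trap_kernel_real_def)
  ultimately show ?thesis
    using trap_kernel_real_cos[of \<xi>] by (simp add: complex_eq_iff has_bochner_integral_iff)
qed

text \<open>
  Kernels that localise in frequency: the transform is \<open>1\<close> within distance \<open>r\<close> of \<open>c\<close> and
  vanishes beyond distance \<open>2 * r\<close>.
\<close>

definition bump :: "real \<Rightarrow> real \<Rightarrow> real \<Rightarrow> complex" where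
  "bump c r = modulate c (dilate r trap_kernel)"

lemma bump_L1: "0 < r \<Longrightarrow> bump c r \<in> L1"
  by (simp add: bump_def modulate_L1 dilate_L1 trap_kernel_L1)

lemma fourier_bump_one:
  assumes "0 < r" "\<bar>\<xi> - c\<bar> \<le> r"
  shows "fourier (bump c r) \<xi> = 1"
proof -
  have "\<bar>(\<xi> - c) / r\<bar> \<le> 1" using assms by simp
  then show ?thesis
    using assms(1) by (simp add: bump_def fourier_modulate fourier_dilate fourier_trap_kernel del: of_real_divide abs_divide)
qed

lemma fourier_bump_zero:
  assumes "0 < r" "2 * r \<le> \<bar>\<xi> - c\<bar>"
  shows "fourier (bump c r) \<xi> = 0"
proof -
  have "2 \<le> \<bar>(\<xi> - c) / r\<bar>" using assms by (simp add: pos_le_divide_eq)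
  then show ?thesis
    using assms(1) by (simp add: bump_def fourier_modulate fourier_dilate fourier_trap_kernel del: of_real_divide abs_divide)
qed

lemma supp_fourier_bump:
  assumes "0 < r" shows "supp (fourier (bump c r)) \<subseteq> cball c (2 * r)"
  unfolding supp_def
proof (rule closure_minimal)
  show "{\<xi>. fourier (bump c r) \<xi> \<noteq> 0} \<subseteq> cball c (2 * r)"
    using fourier_bump_zero[OF assms, of _ c] by (force simp: dist_real_def)
qed simp

lemma modulate_zero: "modulate 0 f = f"
  by (simp add: modulate_def)

text \<open>
  \<open>fourier g\<close> is continuous, hence nearly the constant \<open>fourier g c\<close> on a narrow band around \<open>c\<close>. This
  is that fact in the \<open>L\<^sup>1\<close> norm, which bounds operators, in place of the supremum norm. Modulation
  reduces it to \<open>c = 0\<close>.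
\<close>

lemma convolution_bump_approx:
  assumes g: "g \<in> L1" and "0 < e" "0 < d"
  obtains r where "0 < r" "r < d"
    "L1_norm (\<lambda>t. convolution g (bump c r) t - fourier g c * bump c r t) < e"
proof -
  define X where "X n = inverse (real (Suc n))" for n
  have X: "X \<longlonglongrightarrow> 0" "\<And>n. 0 < X n"
    using LIMSEQ_inverse_real_of_nat by (simp_all add: X_def[abs_def])
  let ?g = "modulate (- c) g"
  have shift: "L1_norm (\<lambda>t. convolution g (bump c r) t - fourier g c * bump c r t)
      = L1_norm (\<lambda>t. convolution ?g (dilate r trap_kernel) t - fourier ?g 0 * dilate r trap_kernel t)" for r
  proof -
    have "convolution g (bump c r) = modulate c (convolution ?g (dilate r trap_kernel))"
      by (simp add: bump_def convolution_modulate[symmetric] modulate_modulate modulate_zero)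
    then have "(\<lambda>t. convolution g (bump c r) t - fourier g c * bump c r t)
        = modulate c (\<lambda>t. convolution ?g (dilate r trap_kernel) t - fourier ?g 0 * dilate r trap_kernel t)"
      by (simp add: fourier_modulate bump_def fun_eq_iff) (simp add: modulate_def left_diff_distrib)
    then show ?thesis by (simp add: L1_norm_modulate)
  qed
  have "(\<lambda>n. L1_norm (\<lambda>t. convolution g (bump c (X n)) t - fourier g c * bump c (X n) t)) \<longlonglongrightarrow> 0"
    unfolding shift
    by (rule convolution_dilate_narrow_tendsto[OF modulate_L1[OF g] trap_kernel_L1 X])
  then have "\<forall>\<^sub>F n in sequentially. L1_norm (\<lambda>t. convolution g (bump c (X n)) t - fourier g c * bump c (X n) t) < e"
    using order_tendstoD(2) assms(2) by blast
  moreover have "\<forall>\<^sub>F n in sequentially. X n < d"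
    using order_tendstoD(2)[OF X(1) assms(3)] .
  ultimately have "\<exists>n. L1_norm (\<lambda>t. convolution g (bump c (X n)) t - fourier g c * bump c (X n) t) < e \<and> X n < d"
    using eventually_happens[OF eventually_conj] by force
  then show ?thesis using that X(2) by blast
qed

section \<open>The action of integrable functions\<close>

lemma scaleC_minus_one: "(-1) *\<^sub>C (x::'a::complex_banach) = - x"
  using scaleC_of_real[of "-1" x] by simp

lemma bounded_linear_scaleC: "bounded_linear (\<lambda>x::'a::complex_banach. c *\<^sub>C x)"
  by (rule bounded_linear_intro[where K="cmod c"])
    (simp_all add: scaleC_add_right norm_scaleC scaleC_scaleC mult.commute flip: scaleC_of_real)

lemma scaleC_diff_left: "(c - d) *\<^sub>C (x::'a::complex_banach) = c *\<^sub>C x - d *\<^sub>C x"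
  using scaleC_add_left[of "c - d" d x] by (simp add: algebra_simps)

context L1_module
begin

lemma act_diff_left:
  assumes "f \<in> L1" "g \<in> L1"
  shows "act (\<lambda>t. f t - g t) x = act f x - act g x"
  using act_add_left[OF assms(1) L1_cmult[OF assms(2), of "-1"]] act_scale_left[OF assms(2), of "-1"]
  by (simp add: scaleC_minus_one)

lemma act_diff_right: "f \<in> L1 \<Longrightarrow> act f (x - y) = act f x - act f y"
  using act_add_right[of f "x - y" y] by (simp add: algebra_simps)

lemma act_zero_right: "f \<in> L1 \<Longrightarrow> act f 0 = 0"
  using act_diff_right[of f 0 0] by simp

lemma norm_act_diff_le:
  assumes "f \<in> L1" "g \<in> L1"
  shows "norm (act f x - act g x) \<le> L1_norm (\<lambda>t. f t - g t) * norm x"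
  using norm_act_le[OF L1_diff[OF assms], of x] by (simp add: act_diff_left[OF assms])

text \<open>
  The action factors through the Fourier transform, so that identities between operators may be
  checked on transforms.
\<close>

lemma act_eq_0_if_fourier_0:
  assumes "f \<in> L1" "\<And>\<xi>. fourier f \<xi> = 0"
  shows "act f x = 0"
  using norm_act_le[OF assms(1), of x] L1_norm_eq_0_if_fourier_0[OF assms] by simp

lemma act_eqI_fourier:
  assumes "f \<in> L1" "g \<in> L1" "\<And>\<xi>. fourier f \<xi> = fourier g \<xi>"
  shows "act f x = act g x"
  using act_eq_0_if_fourier_0[OF L1_diff[OF assms(1,2)]] assms
  by (simp add: fourier_diff act_diff_left)

lemma act_commute:
  assumes "f \<in> L1" "g \<in> L1"
  shows "act f (act g x) = act g (act f x)"
  unfolding act_convolution[OF assms, symmetric] act_convolution[OF assms(2,1), symmetric]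
  using assms by (intro act_eqI_fourier) (simp_all add: convolution_L1 fourier_convolution)

text \<open>
  The transform of the wider bump is \<open>1\<close> wherever that of the narrower one is nonzero. So the range
  of a bump consists of vectors fixed by the bump of twice the width.
\<close>

lemma act_bump_bump:
  assumes "0 < r"
  shows "act (bump c r) (act (bump c (r / 2)) x) = act (bump c (r / 2)) x"
proof -
  have L: "bump c r \<in> L1" "bump c (r / 2) \<in> L1"
    using assms by (simp_all add: bump_L1)
  have "fourier (bump c r) \<xi> * fourier (bump c (r / 2)) \<xi> = fourier (bump c (r / 2)) \<xi>" for \<xi>
    using fourier_bump_one[OF assms, of \<xi> c] fourier_bump_zero[of "r / 2" \<xi> c] assms
    by (cases "\<bar>\<xi> - c\<bar> \<le> r") auto
  then show ?thesis
    unfolding act_convolution[OF L, symmetric]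
    using L by (intro act_eqI_fourier) (simp_all add: convolution_L1 fourier_convolution)
qed

text \<open>
  Vectors concentrated in frequency near \<open>c\<close> are approximate eigenvectors of every \<open>act g\<close>. This is used
  twice: for the local vanishing off the Beurling spectrum, and for the approximate eigenvectors of
  the multiplier operators.
\<close>

lemma approximate_eigenvalue:
  assumes g: "g \<in> L1" and "0 < e" "0 < d"
  obtains r where "0 < r" "r < d"
    "\<And>x. act (bump c r) x = x \<Longrightarrow> norm (act g x - fourier g c *\<^sub>C x) \<le> e * norm x"
proof -
  obtain r where r: "0 < r" "r < d"
    "L1_norm (\<lambda>t. convolution g (bump c r) t - fourier g c * bump c r t) < e"
    using convolution_bump_approx[OF assms] .
  have L: "bump c r \<in> L1" using r by (simp add: bump_L1)
  show ?thesis
  proof (rule that[OF r(1,2)])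
    fix x assume x: "act (bump c r) x = x"
    have "norm (act g x - fourier g c *\<^sub>C x)
        = norm (act (convolution g (bump c r)) x - act (\<lambda>t. fourier g c * bump c r t) x)"
      by (simp add: act_convolution[OF g L] act_scale_left[OF L] x)
    also have "\<dots> \<le> L1_norm (\<lambda>t. convolution g (bump c r) t - fourier g c * bump c r t) * norm x"
      by (rule norm_act_diff_le[OF convolution_L1[OF g L] L1_cmult[OF L]])
    also have "\<dots> \<le> e * norm x"
      using r by (intro mult_right_mono) auto
    finally show "norm (act g x - fourier g c *\<^sub>C x) \<le> e * norm x" .
  qed
qed

section \<open>Spectral localisation\<close>

lemma beurling_spectrum_mono: "N \<subseteq> M \<Longrightarrow> beurling_spectrum act N \<subseteq> beurling_spectrum act M"
  by (auto simp: beurling_spectrum_def)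

lemma closed_beurling_spectrum: "closed (beurling_spectrum act N)"
proof -
  have "beurling_spectrum act N = (\<Inter>f\<in>{f\<in>L1. \<forall>x\<in>N. act f x = 0}. {\<xi>. fourier f \<xi> = 0})"
    by (auto simp: beurling_spectrum_def)
  then show ?thesis
    by (auto intro!: closed_INT closed_Collect_eq continuous_fourier)
qed

lemma beurling_spectrum_act:
  assumes "f \<in> L1"
  shows "beurling_spectrum act {act f x} \<subseteq> beurling_spectrum act {x}"
  by (auto simp: beurling_spectrum_def act_commute[OF _ assms] act_zero_right[OF assms])

text \<open>
  A point outside the interval is the centre of a bump whose transform has product \<open>0\<close> with that of
  \<open>bump c r\<close>; this bump annihilates the vector, and its transform is \<open>1\<close> at the point.
\<close>

lemma beurling_spectrum_act_bump:
  assumes r: "0 < r"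
  shows "beurling_spectrum act {act (bump c r) x} \<subseteq> cball c (2 * r)"
proof
  fix \<xi> assume \<xi>: "\<xi> \<in> beurling_spectrum act {act (bump c r) x}"
  show "\<xi> \<in> cball c (2 * r)"
  proof (rule ccontr)
    assume "\<xi> \<notin> cball c (2 * r)"
    \<comment> \<open>half the gap, as the transform of a bump spreads over twice its width\<close>
    define d where "d = (\<bar>\<xi> - c\<bar> - 2 * r) / 2"
    have d: "0 < d" using \<open>\<xi> \<notin> cball c (2 * r)\<close> by (simp add: d_def dist_real_def abs_minus_commute)
    have L: "bump \<xi> d \<in> L1" "bump c r \<in> L1" using d r by (simp_all add: bump_L1)
    have "fourier (bump \<xi> d) \<eta> * fourier (bump c r) \<eta> = 0" for \<eta>
    proof (cases "2 * r \<le> \<bar>\<eta> - c\<bar>")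
      case False
      moreover have "2 * d = \<bar>\<xi> - c\<bar> - 2 * r" by (simp add: d_def)
      ultimately have "2 * d \<le> \<bar>\<eta> - \<xi>\<bar>" by linarith
      then show ?thesis using fourier_bump_zero[OF d] by simp
    qed (simp add: fourier_bump_zero[OF r])
    then have "act (convolution (bump \<xi> d) (bump c r)) x = 0"
      using L by (intro act_eq_0_if_fourier_0) (simp_all add: convolution_L1 fourier_convolution)
    then have "act (bump \<xi> d) (act (bump c r) x) = 0"
      by (simp add: act_convolution L)
    then have "fourier (bump \<xi> d) \<xi> = 0"
      using \<xi> L by (auto simp: beurling_spectrum_def)
    then show False using fourier_bump_one[OF d, of \<xi> \<xi>] d by simp
  qed
qed

text \<open>
  Some \<open>g\<close> annihilates \<open>x\<close> and has \<open>fourier g c \<noteq> 0\<close>. A component \<open>y\<close> of \<open>x\<close> in a narrow band around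
  \<open>c\<close> satisfies \<open>act g y = 0\<close>, while \<open>act g y\<close> differs from \<open>fourier g c *\<^sub>C y\<close> by at most half the norm
  of the latter; hence \<open>y = 0\<close>.
\<close>

lemma act_bump_eq_0_off_spectrum:
  assumes "c \<notin> beurling_spectrum act {x}"
  obtains r where "0 < r" "act (bump c r) x = 0"
proof -
  obtain g where g: "g \<in> L1" "act g x = 0" "fourier g c \<noteq> 0"
    using assms by (auto simp: beurling_spectrum_def)
  obtain r where r: "0 < r"
    "\<And>y. act (bump c r) y = y \<Longrightarrow> norm (act g y - fourier g c *\<^sub>C y) \<le> cmod (fourier g c) / 2 * norm y"
    using approximate_eigenvalue[OF g(1), of "cmod (fourier g c) / 2" 1 c] g(3) by auto
  define y where "y = act (bump c (r / 2)) x"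
  have L: "bump c (r / 2) \<in> L1" using r by (simp add: bump_L1)
  have "act g y = 0"
    by (simp add: y_def act_commute[OF g(1) L] g act_zero_right L)
  then have "cmod (fourier g c) * norm y \<le> cmod (fourier g c) / 2 * norm y"
    using r(2)[of y] act_bump_bump[OF r(1)] by (simp add: y_def norm_scaleC)
  then have "norm y * cmod (fourier g c) \<le> 0" by simp
  then have "y = 0" using g(3) by (simp add: mult_le_0_iff)
  then show ?thesis using that[of "r / 2"] r(1) by (simp add: y_def)
qed

text \<open>
  Cover \<open>K\<close> by finitely many intervals whose bumps annihilate \<open>x\<close>. Replacing \<open>f\<close> by
  \<open>f - convolution f b\<close> for such a bump \<open>b\<close> does not change \<open>act f x\<close> and removes the interval of \<open>b\<close>
  from the set where the transform is nonzero; in the end the transform vanishes.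
\<close>

lemma act_eq_0_if_fourier_off_spectrum:
  assumes f: "f \<in> L1" and K: "compact K" "{\<xi>. fourier f \<xi> \<noteq> 0} \<subseteq> K"
    and disj: "K \<inter> beurling_spectrum act {x} = {}"
  shows "act f x = 0"
proof -
  have "\<forall>c\<in>K. \<exists>r. 0 < r \<and> act (bump c r) x = 0"
    using act_bump_eq_0_off_spectrum disj by blast
  then obtain r where r: "\<And>c. c \<in> K \<Longrightarrow> 0 < r c" "\<And>c. c \<in> K \<Longrightarrow> act (bump c (r c)) x = 0"
    by metis
  obtain D where D: "D \<subseteq> K" "finite D" "K \<subseteq> (\<Union>c\<in>D. ball c (r c))"
    using compactE_image[OF K(1), of K "\<lambda>c. ball c (r c)"] r(1) by force
  have "act f x = 0" if "f \<in> L1" "{\<xi>. fourier f \<xi> \<noteq> 0} \<subseteq> (\<Union>c\<in>D. ball c (r c))" for f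
    using D(2,1) that
  proof (induction D arbitrary: f rule: finite_induct)
    case empty
    then show ?case by (intro act_eq_0_if_fourier_0) auto
  next
    case (insert c D)
    have c: "c \<in> K" using insert by simp
    have L: "bump c (r c) \<in> L1" using r(1)[OF c] by (rule bump_L1)
    let ?f = "\<lambda>t. f t - convolution f (bump c (r c)) t"
    have "act ?f x = 0"
    proof (rule insert.IH)
      show "?f \<in> L1" using insert L by (intro L1_diff convolution_L1)
      show "{\<xi>. fourier ?f \<xi> \<noteq> 0} \<subseteq> (\<Union>c\<in>D. ball c (r c))"
      proof
        fix \<xi> assume "\<xi> \<in> {\<xi>. fourier ?f \<xi> \<noteq> 0}"
        then have ne: "fourier f \<xi> * (1 - fourier (bump c (r c)) \<xi>) \<noteq> 0"
          using insert.prems L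
          by (simp add: fourier_diff convolution_L1 fourier_convolution right_diff_distrib)
        then have "\<xi> \<notin> ball c (r c)"
          using fourier_bump_one[OF r(1)[OF c], of \<xi> c] by (auto simp: dist_real_def abs_minus_commute)
        moreover have "\<xi> \<in> (\<Union>c\<in>insert c D. ball c (r c))" using ne insert.prems(3) by auto
        ultimately show "\<xi> \<in> (\<Union>c\<in>D. ball c (r c))" by auto
      qed
    qed (use insert in auto)
    then show ?case
      using insert.prems L r(2)[OF c]
      by (simp add: act_diff_left convolution_L1 act_convolution act_zero_right)
  qed
  then show ?thesis using f K(2) D(3) by blast
qed

text \<open>
  The action on \<open>x\<close> only sees transforms near the Beurling spectrum of \<open>x\<close>.
\<close>

lemma act_eqI_near_spectrum:
  assumes "f \<in> L1" "g \<in> L1" and "compact K" "\<And>\<xi>. \<xi> \<notin> K \<Longrightarrow> fourier f \<xi> = fourier g \<xi>"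
    and "open U" "beurling_spectrum act {x} \<subseteq> U" "\<And>\<xi>. \<xi> \<in> U \<Longrightarrow> fourier f \<xi> = fourier g \<xi>"
  shows "act f x = act g x"
proof -
  have "act (\<lambda>t. f t - g t) x = 0"
  proof (rule act_eq_0_if_fourier_off_spectrum)
    show "compact (K - U)" using assms by (simp add: compact_diff)
    show "{\<xi>. fourier (\<lambda>t. f t - g t) \<xi> \<noteq> 0} \<subseteq> K - U"
      using assms by (auto simp: fourier_diff)
  qed (use assms in \<open>auto simp: L1_diff\<close>)
  then show ?thesis using assms by (simp add: act_diff_left)
qed

text \<open>
  Wide bumps centred at \<open>0\<close> form an approximate identity, so functions with compactly supported
  transform are dense in \<open>L\<^sup>1\<close>.
\<close>

lemma act_eq_0_if_band_limited:
  assumes f: "f \<in> L1"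
    and zero: "\<And>g K. g \<in> L1 \<Longrightarrow> compact K \<Longrightarrow> {\<xi>. fourier g \<xi> \<noteq> 0} \<subseteq> K \<Longrightarrow> act g x = 0"
  shows "act f x = 0"
proof -
  define X where "X n = inverse (real (Suc n))" for n
  have X: "X \<longlonglongrightarrow> 0" "\<And>n. 0 < X n"
    using LIMSEQ_inverse_real_of_nat by (simp_all add: X_def[abs_def])
  have b: "dilate (1 / X n) trap_kernel = bump 0 (1 / X n)" for n
    by (simp add: bump_def modulate_zero)
  have one: "fourier trap_kernel 0 = 1" by (simp add: fourier_trap_kernel)
  have "norm (act f x) \<le> L1_norm (\<lambda>t. convolution (bump 0 (1 / X n)) f t - f t) * norm x" for n
  proof -
    have L: "bump 0 (1 / X n) \<in> L1" using X(2)[of n] by (simp add: bump_L1)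
    have "act (convolution (bump 0 (1 / X n)) f) x = 0"
    proof (rule zero)
      have "{\<xi>. fourier (bump 0 (1 / X n)) \<xi> \<noteq> 0} \<subseteq> supp (fourier (bump 0 (1 / X n)))"
        unfolding supp_def by (rule closure_subset)
      also have "\<dots> \<subseteq> cball 0 (2 * (1 / X n))"
        using X(2)[of n] by (intro supp_fourier_bump) simp
      finally show "{\<xi>. fourier (convolution (bump 0 (1 / X n)) f) \<xi> \<noteq> 0} \<subseteq> cball 0 (2 * (1 / X n))"
        unfolding fourier_convolution[OF L f] by auto
    qed (simp_all add: convolution_L1 L f)
    then show ?thesis
      using norm_act_diff_le[OF convolution_L1[OF L f] f, of x] by simp
  qed
  moreover have "(\<lambda>n. L1_norm (\<lambda>t. convolution (bump 0 (1 / X n)) f t - f t) * norm x) \<longlonglongrightarrow> 0 * norm x"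
    using convolution_dilate_wide_tendsto[OF trap_kernel_L1 f X]
    by (intro tendsto_mult tendsto_const) (simp add: b one)
  ultimately have "norm (act f x) \<le> 0 * norm x"
    by (intro LIMSEQ_le_const) auto
  then show ?thesis by simp
qed

text \<open>
  For band limited \<open>g\<close>, the functions \<open>convolution g \<phi>\<close> and \<open>g\<close> have transforms that agree near the spectrum
  of \<open>x\<close> and outside a compact set, so \<open>act g\<close> annihilates \<open>act \<phi> x - x\<close>. By density every \<open>act f\<close>
  does, and the module is nondegenerate.
\<close>

lemma act_cutoff:
  assumes nd: "nondegenerate act" and \<phi>: "cutoff (beurling_spectrum act {x}) \<phi>"
  shows "act \<phi> x = x"
proof -
  obtain U where U: "\<phi> \<in> L1" "open U" "beurling_spectrum act {x} \<subseteq> U" "\<And>\<xi>. \<xi> \<in> U \<Longrightarrow> fourier \<phi> \<xi> = 1"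
    using \<phi> by (auto simp: cutoff_def)
  have "act f (act \<phi> x - x) = 0" if f: "f \<in> L1" for f
  proof (rule act_eq_0_if_band_limited[OF f])
    fix g K assume g: "g \<in> L1" "compact K" "{\<xi>. fourier g \<xi> \<noteq> 0} \<subseteq> K"
    have "act (convolution g \<phi>) x = act g x"
      using g U by (intro act_eqI_near_spectrum[where K=K and U=U])
        (auto simp: convolution_L1 fourier_convolution)
    then show "act g (act \<phi> x - x) = 0"
      using g U by (simp add: act_diff_right act_convolution)
  qed
  then have "act \<phi> x - x = 0" using nd unfolding nondegenerate_def by blast
  then show ?thesis by simp
qed

lemma cutoff_mono: "cutoff K \<phi> \<Longrightarrow> K' \<subseteq> K \<Longrightarrow> cutoff K' \<phi>"
  by (auto simp: cutoff_def)

lemma X_comp_mono: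
  "x \<in> X_comp act \<Longrightarrow> beurling_spectrum act {y} \<subseteq> beurling_spectrum act {x} \<Longrightarrow> y \<in> X_comp act"
  unfolding X_comp_def
  by (metis (mono_tags) closed_beurling_spectrum compact_Int_closed inf.absorb_iff2 mem_Collect_eq)

end

lemma FL1_inv_fourier:
  assumes "h \<in> FL1"
  shows "inv_fourier h \<in> L1" "fourier (inv_fourier h) = h"
proof -
  have "\<exists>f. f \<in> L1 \<and> fourier f = h" using assms by (auto simp: FL1_def)
  then have "inv_fourier h \<in> L1 \<and> fourier (inv_fourier h) = h"
    unfolding inv_fourier_def by (rule someI_ex)
  then show "inv_fourier h \<in> L1" "fourier (inv_fourier h) = h" by auto
qed

lemma FL1_loc_cutoff: "h \<in> FL1_loc \<Longrightarrow> cutoff K \<phi> \<Longrightarrow> (\<lambda>\<xi>. h \<xi> * fourier \<phi> \<xi>) \<in> FL1"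
  by (auto simp: FL1_loc_def cutoff_def)

section \<open>Multiplier operators\<close>

context L1_module
begin

text \<open>
  Inserting the cutoff once more, the left side is the action on \<open>x\<close> of a function with transform
  \<open>(z - h) * g * (fourier \<phi>)\<^sup>2\<close>. Near the spectrum of \<open>x\<close> this equals \<open>(fourier \<phi>)\<^sup>2\<close>, and \<open>\<phi>\<close> acts on
  \<open>x\<close> as the identity.
\<close>

lemma multiplier_inverse_identity:
  assumes nd: "nondegenerate act" and h: "h \<in> FL1_loc" and g: "g \<in> FL1_loc"
    and U: "open U" "beurling_spectrum act {x} \<subseteq> U" "\<And>\<xi>. \<xi> \<in> U \<Longrightarrow> g \<xi> * (z - h \<xi>) = 1"
    and \<phi>: "cutoff (beurling_spectrum act {x}) \<phi>"
  defines "H \<equiv> inv_fourier (\<lambda>\<xi>. h \<xi> * fourier \<phi> \<xi>)"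
    and "G \<equiv> inv_fourier (\<lambda>\<xi>. g \<xi> * fourier \<phi> \<xi>)"
  shows "z *\<^sub>C act G x - act H (act G x) = x"
proof -
  note H = FL1_inv_fourier[OF FL1_loc_cutoff[OF h \<phi>], folded H_def]
  note G = FL1_inv_fourier[OF FL1_loc_cutoff[OF g \<phi>], folded G_def]
  have \<phi>L: "\<phi> \<in> L1" "compact (supp (fourier \<phi>))" using \<phi> by (auto simp: cutoff_def)
  let ?P = "\<lambda>t. z * \<phi> t - H t"
  have P: "?P \<in> L1" by (intro L1_diff L1_cmult H \<phi>L)
  have "z *\<^sub>C act G x - act H (act G x) = act ?P (act G x)"
    using act_cutoff[OF nd \<phi>]
    by (simp add: act_diff_left[OF L1_cmult[OF \<phi>L(1)] H(1)] act_scale_left[OF \<phi>L(1)] act_commute[OF \<phi>L(1) G(1)])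
  also have "\<dots> = act (convolution ?P G) x"
    by (simp add: act_convolution P G)
  also have "\<dots> = act (convolution \<phi> \<phi>) x"
  proof (rule act_eqI_near_spectrum[OF _ _ \<phi>L(2) _ U(1,2)])
    have F: "fourier (convolution ?P G) \<xi> = (z - h \<xi>) * g \<xi> * (fourier \<phi> \<xi> * fourier \<phi> \<xi>)" for \<xi>
      using fourier_convolution[OF P G(1), of \<xi>] fourier_diff[OF L1_cmult[OF \<phi>L(1)] H(1), of z \<xi>]
      by (simp add: fourier_cmult H G algebra_simps)
    show "fourier (convolution ?P G) \<xi> = fourier (convolution \<phi> \<phi>) \<xi>" if "\<xi> \<in> U" for \<xi>
      using U(3)[OF that] by (simp add: F fourier_convolution \<phi>L mult.commute)
    show "fourier (convolution ?P G) \<xi> = fourier (convolution \<phi> \<phi>) \<xi>" if "\<xi> \<notin> supp (fourier \<phi>)" for \<xi>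
    proof -
      have "fourier \<phi> \<xi> = 0" using that closure_subset by (force simp: supp_def)
      then show ?thesis by (simp add: F fourier_convolution \<phi>L)
    qed
  qed (simp_all add: convolution_L1 P G \<phi>L)
  also have "\<dots> = x"
    by (simp add: act_convolution \<phi>L act_cutoff[OF nd \<phi>])
  finally show ?thesis .
qed

text \<open>
  Before closures are taken the two operators are exactly inverse to each other: both are defined on the
  vectors with compact spectrum, and applying an integrable function never enlarges the spectrum, so
  that one cutoff serves for a vector and for its image.
\<close>

lemma converse_shift_multiplier_op_comp:
  assumes nd: "nondegenerate act" and h: "h \<in> FL1_loc" and g: "g \<in> FL1_loc"
    and U: "open U" "beurling_spectrum act UNIV \<subseteq> U" "\<And>\<xi>. \<xi> \<in> U \<Longrightarrow> g \<xi> * (z - h \<xi>) = 1"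
  shows "(shift_op z (multiplier_op_comp act h))\<inverse> = multiplier_op_comp act g"
proof -
  define H where "H \<phi> = inv_fourier (\<lambda>\<xi>. h \<xi> * fourier \<phi> \<xi>)" for \<phi>
  define G where "G \<phi> = inv_fourier (\<lambda>\<xi>. g \<xi> * fourier \<phi> \<xi>)" for \<phi>
  have Ux: "beurling_spectrum act {x} \<subseteq> U" for x
    using beurling_spectrum_mono[of "{x}" UNIV] U(2) by auto
  have HL: "H \<phi> \<in> L1" if "cutoff K \<phi>" for K \<phi>
    unfolding H_def by (rule FL1_inv_fourier[OF FL1_loc_cutoff[OF h that]])
  have GL: "G \<phi> \<in> L1" if "cutoff K \<phi>" for K \<phi>
    unfolding G_def by (rule FL1_inv_fourier[OF FL1_loc_cutoff[OF g that]])
  have inv: "z *\<^sub>C act (G \<phi>) x - act (H \<phi>) (act (G \<phi>) x) = x"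
    if "cutoff (beurling_spectrum act {x}) \<phi>" for \<phi> x
    unfolding H_def G_def by (rule multiplier_inverse_identity[OF nd h g U(1) Ux U(3) that])
  show ?thesis
  proof (intro set_eqI iffI)
    fix p assume "p \<in> (shift_op z (multiplier_op_comp act h))\<inverse>"
    then obtain x \<phi> where x: "x \<in> X_comp act" "cutoff (beurling_spectrum act {x}) \<phi>"
      and p: "p = (z *\<^sub>C x - act (H \<phi>) x, x)"
      by (auto simp: shift_op_def multiplier_op_comp_def H_def)
    have \<phi>L: "\<phi> \<in> L1" using x(2) by (simp add: cutoff_def)
    define u where "u = z *\<^sub>C x - act (H \<phi>) x"
    have "u = act (\<lambda>t. z * \<phi> t - H \<phi> t) x"
      using act_cutoff[OF nd x(2)]
      by (simp add: u_def act_diff_left[OF L1_cmult[OF \<phi>L] HL[OF x(2)]] act_scale_left[OF \<phi>L])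
    then have sub: "beurling_spectrum act {u} \<subseteq> beurling_spectrum act {x}"
      using beurling_spectrum_act[OF L1_diff[OF L1_cmult[OF \<phi>L] HL[OF x(2)]]] by simp
    have "act (G \<phi>) u = x"
      using inv[OF x(2)] HL[OF x(2)] GL[OF x(2)]
      by (simp add: u_def act_diff_right act_scale_right act_commute)
    then show "p \<in> multiplier_op_comp act g"
      using X_comp_mono[OF x(1) sub] cutoff_mono[OF x(2) sub]
      unfolding multiplier_op_comp_def p u_def[symmetric] G_def by force
  next
    fix p assume "p \<in> multiplier_op_comp act g"
    then obtain u \<phi> where u: "u \<in> X_comp act" "cutoff (beurling_spectrum act {u}) \<phi>"
      and p: "p = (u, act (G \<phi>) u)"
      by (auto simp: multiplier_op_comp_def G_def)
    define v where "v = act (G \<phi>) u"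
    have sub: "beurling_spectrum act {v} \<subseteq> beurling_spectrum act {u}"
      unfolding v_def by (rule beurling_spectrum_act[OF GL[OF u(2)]])
    have "(v, act (H \<phi>) v) \<in> multiplier_op_comp act h"
      using X_comp_mono[OF u(1) sub] cutoff_mono[OF u(2) sub]
      unfolding multiplier_op_comp_def H_def by force
    moreover have "u = z *\<^sub>C v - act (H \<phi>) v"
      using inv[OF u(2)] by (simp add: v_def)
    ultimately show "p \<in> (shift_op z (multiplier_op_comp act h))\<inverse>"
      unfolding p v_def[symmetric] shift_op_def by auto
  qed
qed

text \<open>
  As \<open>c\<close> lies in the spectrum of the module, no bump centred at \<open>c\<close> acts as \<open>0\<close>. A nonzero vector in the range of a
  narrow one is nearly an eigenvector of every integrable function. On all these vectors one fixed
  cutoff can be used, so the operator of \<open>h\<close> acts there as one integrable function.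
\<close>

lemma multiplier_op_approximate_eigenvector:
  assumes h: "h \<in> FL1_loc" and c: "c \<in> beurling_spectrum act UNIV" and e: "0 < e"
  obtains x y where "x \<noteq> 0" "(x, y) \<in> multiplier_op_comp act h" "norm (y - h c *\<^sub>C x) \<le> e * norm x"
proof -
  \<comment> \<open>the spectra of the vectors below lie in \<open>cball c 1\<close>, because their bumps have radius below \<open>1 / 2\<close>\<close>
  have cut: "cutoff (cball c 1) (bump c 2)"
    unfolding cutoff_def
  proof (intro conjI exI[of _ "ball c 2"] ballI)
    show "compact (supp (fourier (bump c 2)))"
      using supp_fourier_bump[of 2 c] closed_closure[of "{\<xi>. fourier (bump c 2) \<xi> \<noteq> 0}"]
      by (auto simp: supp_def compact_eq_bounded_closed intro: bounded_subset[OF bounded_cball])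
    show "fourier (bump c 2) \<xi> = 1" if "\<xi> \<in> ball c 2" for \<xi>
      using that by (intro fourier_bump_one) (auto simp: dist_real_def abs_minus_commute)
  qed (auto simp: bump_L1 subset_iff)
  define H where "H = inv_fourier (\<lambda>\<xi>. h \<xi> * fourier (bump c 2) \<xi>)"
  note H = FL1_inv_fourier[OF FL1_loc_cutoff[OF h cut], folded H_def]
  have Hc: "fourier H c = h c" by (simp add: H fourier_bump_one)
  obtain r where r: "0 < r" "r < 1"
    "\<And>x. act (bump c r) x = x \<Longrightarrow> norm (act H x - fourier H c *\<^sub>C x) \<le> e * norm x"
    using approximate_eigenvalue[OF H(1) e zero_less_one] by blast
  have L: "bump c (r / 2) \<in> L1" using r by (simp add: bump_L1)
  have "fourier (bump c (r / 2)) c \<noteq> 0" using r by (simp add: fourier_bump_one)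
  then obtain w where w: "act (bump c (r / 2)) w \<noteq> 0"
    using c L by (auto simp: beurling_spectrum_def)
  define x where "x = act (bump c (r / 2)) w"
  have sp: "beurling_spectrum act {x} \<subseteq> cball c 1"
    using beurling_spectrum_act_bump[of "r / 2" c w] r by (force simp: x_def)
  have "x \<in> X_comp act"
    unfolding X_comp_def using sp closed_beurling_spectrum[of "{x}"]
    by (auto simp: compact_eq_bounded_closed intro: bounded_subset[OF bounded_cball])
  then have "(x, act H x) \<in> multiplier_op_comp act h"
    using cutoff_mono[OF cut sp] unfolding multiplier_op_comp_def H_def by blast
  moreover have "norm (act H x - h c *\<^sub>C x) \<le> e * norm x"
    using r(3)[of x] act_bump_bump[OF r(1)] by (simp add: x_def Hc)
  ultimately show ?thesis using that w by (simp add: x_def)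
qed

end

text \<open>
  Passing from \<open>A\<close> to the inverse of \<open>z - A\<close> moves the graph by \<open>(x, y) \<mapsto> (z *\<^sub>C x - y, x)\<close>, a homeomorphism of
  the product space, which commutes with closures.
\<close>

lemma converse_shift_closure:
  "(shift_op z (closure A))\<inverse> = closure ((shift_op z A)\<inverse>)" for A :: "('a::complex_banach \<times> 'a) set"
proof -
  define P :: "'a \<times> 'a \<Rightarrow> 'a \<times> 'a" where "P = (\<lambda>(x, y). (z *\<^sub>C x - y, x))"
  define Q :: "'a \<times> 'a \<Rightarrow> 'a \<times> 'a" where "Q = (\<lambda>(u, v). (v, z *\<^sub>C v - u))"
  have conv: "(shift_op z B)\<inverse> = P ` B" for B
    by (force simp: shift_op_def P_def)
  have PQ: "P (Q p) = p" "Q (P p) = p" for p by (simp_all add: P_def Q_def split: prod.split)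
  have contC: "continuous_on S (\<lambda>p. z *\<^sub>C f p)" if "continuous_on S f" for S and f :: "'a \<times> 'a \<Rightarrow> 'a"
    using bounded_linear.continuous_on[OF bounded_linear_scaleC that] .
  have cont: "continuous_on UNIV P" "continuous_on UNIV Q"
    unfolding P_def Q_def case_prod_unfold by (intro continuous_intros contC)+
  have img: "F ` closure B \<subseteq> closure (F ` B)" if "continuous_on UNIV F" for F :: "'a \<times> 'a \<Rightarrow> 'a \<times> 'a" and B
    using that by (intro image_closure_subset) (auto intro: continuous_on_subset closure_subset[THEN subsetD])
  have "closure (P ` A) = P ` Q ` closure (P ` A)" by (simp add: image_image PQ)
  also have "\<dots> \<subseteq> P ` closure (Q ` P ` A)" by (intro image_mono img cont)
  also have "\<dots> = P ` closure A" by (simp add: image_image PQ)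
  finally show ?thesis unfolding conv using img[OF cont(1), of A] by auto
qed

text \<open>
  A bounded inverse of \<open>z - A\<close> bounds \<open>z - A\<close> from below. At approximate eigenvectors for a value \<open>h c\<close> close to \<open>z\<close>
  this fails.
\<close>

lemma (in L1_module) closure_image_multiplier_subset_op_spectrum:
  assumes h: "h \<in> FL1_loc"
  shows "closure (h ` beurling_spectrum act UNIV) \<subseteq> op_spectrum (multiplier_op act h)"
proof
  fix z assume z: "z \<in> closure (h ` beurling_spectrum act UNIV)"
  show "z \<in> op_spectrum (multiplier_op act h)"
    unfolding op_spectrum_def op_resolvent_set_def in_B_def
  proof (rule, clarify)
    fix S assume S: "bounded_clinear S" "(shift_op z (multiplier_op act h))\<inverse> = graph_of S"
    obtain K where K: "0 < K" "\<And>u. norm (S u) \<le> norm u * K"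
      using S(1) bounded_linear.pos_bounded unfolding bounded_clinear_def by blast
    \<comment> \<open>two errors of size \<open>e\<close>, magnified by \<open>K\<close>, still leave only half the norm of \<open>x\<close>\<close>
    define e where "e = 1 / (4 * K)"
    have e: "0 < e" using K by (simp add: e_def)
    obtain c where c: "c \<in> beurling_spectrum act UNIV" "dist (h c) z < e"
      using z e by (auto simp: closure_approachable)
    obtain x y where xy: "x \<noteq> 0" "(x, y) \<in> multiplier_op_comp act h" "norm (y - h c *\<^sub>C x) \<le> e * norm x"
      using multiplier_op_approximate_eigenvector[OF h c(1) e] .
    have "(x, y) \<in> multiplier_op act h"
      using xy(2) closure_subset unfolding multiplier_op_def by blast
    then have "(z *\<^sub>C x - y, x) \<in> graph_of S"
      unfolding S(2)[symmetric] by (auto simp: shift_op_def)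
    then have "norm x \<le> norm (z *\<^sub>C x - y) * K"
      using K(2)[of "z *\<^sub>C x - y"] by (auto simp: graph_of_def)
    also have "z *\<^sub>C x - y = (z - h c) *\<^sub>C x - (y - h c *\<^sub>C x)"
      by (simp add: scaleC_diff_left)
    also have "norm \<dots> * K \<le> (cmod (z - h c) * norm x + e * norm x) * K"
      using norm_triangle_ineq4[of "(z - h c) *\<^sub>C x" "y - h c *\<^sub>C x"] xy(3) K(1)
      by (intro mult_right_mono) (auto simp: norm_scaleC)
    also have "\<dots> \<le> (e * norm x + e * norm x) * K"
      using c(2) K(1) by (intro mult_right_mono add_right_mono) (auto simp: dist_norm norm_minus_commute)
    also have "\<dots> = norm x / 2"
      using K(1) by (simp add: e_def)
    finally show False using xy(1) by simp
  qed
qed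

theorem theorem3p5:
  fixes act :: "(real \<Rightarrow> complex) \<Rightarrow> 'a::complex_banach \<Rightarrow> 'a"
    and T :: "real \<Rightarrow> 'a \<Rightarrow> 'a"
    and h :: "real \<Rightarrow> complex"
  assumes "L1_module act"
    and "nondegenerate act"
    and "isometric_representation T"
    and "associated act T"
    and "h \<in> FL1_loc"
    and "X_regular act h"
  shows "op_spectrum (multiplier_op act h) = closure (h ` beurling_spectrum act UNIV) \<and>
    (\<forall>z g. z \<notin> closure (h ` beurling_spectrum act UNIV) \<longrightarrow> regularity_witness act h z g \<longrightarrow>
       (shift_op z (multiplier_op act h))\<inverse> = multiplier_op act g)"
proof -
  interpret L1_module act by fact
  have inverse: "(shift_op z (multiplier_op act h))\<inverse> = multiplier_op act g"
    if g: "regularity_witness act h z g" for z g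
  proof -
    obtain U where "g \<in> FL1_loc" "open U" "beurling_spectrum act UNIV \<subseteq> U"
        "\<And>\<xi>. \<xi> \<in> U \<Longrightarrow> g \<xi> * (z - h \<xi>) = 1"
      using g by (auto simp: regularity_witness_def)
    then show ?thesis
      unfolding multiplier_op_def converse_shift_closure
      using converse_shift_multiplier_op_comp assms(2,5) by metis
  qed
  have "op_spectrum (multiplier_op act h) \<subseteq> closure (h ` beurling_spectrum act UNIV)"
  proof
    fix z assume z: "z \<in> op_spectrum (multiplier_op act h)"
    show "z \<in> closure (h ` beurling_spectrum act UNIV)"
    proof (rule ccontr)
      assume "z \<notin> closure (h ` beurling_spectrum act UNIV)"
      then obtain g where g: "regularity_witness act h z g"
        using assms(6) by (auto simp: X_regular_def)
      then have "in_B ((shift_op z (multiplier_op act h))\<inverse>)"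
        unfolding inverse[OF g] by (simp add: regularity_witness_def)
      then show False using z by (simp add: op_spectrum_def op_resolvent_set_def)
    qed
  qed
  then show ?thesis
    using closure_image_multiplier_subset_op_spectrum[OF assms(5)] inverse by blast
qed

end
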